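(* Let $A$ be a unital C$^*$-algebra, and let $p$ be a positive norm-one element in $A$. Then the following statements are equivalent: (a) $p$ is a projection in $A$. (b) $\mathrm{Sph}_{S_{A^+}}\left(\mathrm{Sph}_{S_{A^+}}(p)\right) = \{p\}$.
   Context: For a C$^*$-algebra $A$, $A^+$ is its positive cone and $S_{A^+}=\{x\in A^+ : \|x\|=1\}$ is the positive portion of its unit sphere. For subsets $\mathscr{S}, P\subseteq A$, the unit sphere around $\mathscr{S}$ in $P$ is $\mathrm{Sph}_P(\mathscr{S}) := \{x\in P : \|x-s\|=1 \text{ for all } s\in \mathscr{S}\}$ (so $\mathrm{Sph}_P(\emptyset)=P$); for $a\in A$, $\mathrm{Sph}_P(a)$ means $\mathrm{Sph}_P(\{a\})$. A projection is an element $p$ with $p=p^*=p^2$. *)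

theory Defs
  imports "HOL-Analysis.Analysis"
begin

(* The axioms 0 \<noteq> 1 and norm 1 = 1 of real_normed_algebra_1 only rule out the zero algebra:
   in a unital C*-algebra norm 1 = (norm 1)^2. *)
class unital_cstar_algebra = real_normed_algebra_1 + banach +
  fixes scaleC :: "complex \<Rightarrow> 'a \<Rightarrow> 'a"  (infixr \<open>*\<^sub>C\<close> 75)
    and star :: "'a \<Rightarrow> 'a"
  assumes scaleC_add_right: "a *\<^sub>C (x + y) = a *\<^sub>C x + a *\<^sub>C y"
    and scaleC_add_left: "(a + b) *\<^sub>C x = a *\<^sub>C x + b *\<^sub>C x"
    and scaleC_scaleC: "a *\<^sub>C b *\<^sub>C x = (a * b) *\<^sub>C x"
    and scaleC_of_real: "complex_of_real r *\<^sub>C x = r *\<^sub>R x"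
    and scaleC_mult_left: "(a *\<^sub>C x) * y = a *\<^sub>C (x * y)"
    and scaleC_mult_right: "x * (a *\<^sub>C y) = a *\<^sub>C (x * y)"
    and norm_scaleC: "norm (a *\<^sub>C x) = cmod a * norm x"
    and star_star: "star (star x) = x"
    and star_add: "star (x + y) = star x + star y"
    and star_scaleC: "star (a *\<^sub>C x) = cnj a *\<^sub>C star x"
    and star_mult: "star (x * y) = star y * star x"
    and cstar_identity: "norm (star x * x) = (norm x)\<^sup>2"

definition is_invertible :: "'a::monoid_mult \<Rightarrow> bool" where
  "is_invertible x \<longleftrightarrow> (\<exists>y. x * y = 1 \<and> y * x = 1)"

definition spectrum :: "'a::unital_cstar_algebra \<Rightarrow> complex set" where
  "spectrum x = {z. \<not> is_invertible (z *\<^sub>C 1 - x)}"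

definition pos_cone :: "'a::unital_cstar_algebra set" where
  "pos_cone = {x. star x = x \<and> (\<forall>z \<in> spectrum x. \<exists>r\<ge>0. z = complex_of_real r)}"

definition pos_sphere :: "'a::unital_cstar_algebra set" where
  "pos_sphere = {x \<in> pos_cone. norm x = 1}"

definition Sph :: "'a::real_normed_vector set \<Rightarrow> 'a set \<Rightarrow> 'a set" where
  "Sph P S = {x \<in> P. \<forall>s \<in> S. norm (x - s) = 1}"

definition is_projection :: "'a::unital_cstar_algebra \<Rightarrow> bool" where
  "is_projection p \<longleftrightarrow> p = star p \<and> p = p\<^sup>2"

end

theory Submission
  imports Defs "HOL-Computational_Algebra.Fundamental_Theorem_Algebra"
begin

text \<open>For positive contractions \<open>x\<close> and \<open>y\<close> one has \<open>\<parallel>x - y\<parallel> \<le> 1\<close>, and equality has a geometric meaning: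
  in a representation on a Hilbert space there are unit vectors that one of \<open>x\<close>, \<open>y\<close> nearly fixes and
  the other nearly annihilates. No representation is needed to say this. If \<open>1\<close> belongs to
  the spectrum of \<open>x - y\<close>, the powers of \<open>(1 + x - y)/2\<close> are elements of norm \<open>1\<close> of the algebra that
  play the role of the vectors (\<open>norm_diff_eq_1_cases\<close>), and inequalities between vectors become
  inequalities between elements \<open>z\<^sup>*az\<close> with \<open>a\<close> positive (\<open>norm_mult_pos_cone_le\<close>).

  A vector nearly fixed or nearly annihilated by \<open>p\<close> is treated in the same way by \<open>p\<^sup>2\<close>. So \<open>p\<^sup>2\<close> has
  distance \<open>1\<close> from every element of the sphere around \<open>p\<close> (\<open>square_mem_double_sphere\<close>), and if
  \<open>p\<close> is the only such element, \<open>p = p\<^sup>2\<close>.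

  Conversely let \<open>p\<close> be a projection and \<open>y \<noteq> p\<close> positive of norm \<open>1\<close>. One has to find \<open>x\<close> in the
  sphere around \<open>p\<close> with \<open>\<parallel>x - y\<parallel> < 1\<close>. If \<open>pyp = p\<close>, then \<open>y - p\<close> is positive, nonzero and orthogonal to
  \<open>p\<close>, and \<open>x\<close> arises from \<open>y\<close> by normalising this summand (\<open>close_element_if_corner_eq\<close>). Otherwise
  there are directions in the range of \<open>p\<close> in which \<open>y\<close> is smaller than \<open>p\<close>; cutting \<open>y\<close> down to vanish
  there puts it at distance \<open>1\<close> from \<open>p\<close> and, after normalisation, still at distance less than \<open>1\<close> from
  \<open>y\<close> (\<open>close_element_if_corner_ne\<close>).

  What this requires of the theory of C*-algebras is developed from the axioms. A self-adjoint element has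
  real spectrum and its norm is the absolute value of a spectral value
  (\<open>spectrum_selfadjoint_norm\<close>). Hence real polynomials in it are bounded by their values on the spectrum
  (\<open>norm_real_poly_apply_le\<close>), which gives square roots of positive elements by approximation
  (\<open>pos_cone_sqrt\<close>) and with them the positivity of \<open>a\<^sup>*a\<close> (\<open>star_mult_pos_cone\<close>).\<close>

section \<open>Arithmetic of the involution and of complex scalars\<close>

lemma scaleC_one [simp]: "1 *\<^sub>C (x::'a::unital_cstar_algebra) = x"
  using scaleC_of_real[of 1 x] by simp

lemma scaleC_zero_left [simp]: "0 *\<^sub>C (x::'a::unital_cstar_algebra) = 0"
  using scaleC_of_real[of 0 x] by simp

lemma scaleC_zero_right [simp]: "a *\<^sub>C (0::'a::unital_cstar_algebra) = 0"
  using scaleC_add_right[of a 0 0] by simp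

lemma scaleC_minus_left [simp]: "(- a) *\<^sub>C (x::'a::unital_cstar_algebra) = - (a *\<^sub>C x)"
  using scaleC_add_left[of a "- a" x] by (simp add: eq_neg_iff_add_eq_0 add.commute)

lemma scaleC_minus_right [simp]: "a *\<^sub>C (- x::'a::unital_cstar_algebra) = - (a *\<^sub>C x)"
  using scaleC_add_right[of a x "- x"] by (simp add: eq_neg_iff_add_eq_0 add.commute)

lemma scaleC_diff_left: "(a - b) *\<^sub>C (x::'a::unital_cstar_algebra) = a *\<^sub>C x - b *\<^sub>C x"
  using scaleC_add_left[of a "- b" x] by simp

lemma scaleC_diff_right: "a *\<^sub>C (x - y::'a::unital_cstar_algebra) = a *\<^sub>C x - a *\<^sub>C y"
  using scaleC_add_right[of a x "- y"] by simp

lemma scaleC_power: "(a *\<^sub>C (x::'a::unital_cstar_algebra)) ^ n = (a ^ n) *\<^sub>C (x ^ n)"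
  by (induction n) (auto simp: scaleC_mult_left scaleC_mult_right scaleC_scaleC mult.commute)


lemma scaleC_sum_left: "(\<Sum>i\<in>I. f i) *\<^sub>C (x::'a::unital_cstar_algebra) = (\<Sum>i\<in>I. f i *\<^sub>C x)"
  by (induction I rule: infinite_finite_induct) (auto simp: scaleC_add_left)

lemma star_zero [simp]: "star (0::'a::unital_cstar_algebra) = 0"
  using star_add[of 0 "0::'a"] by simp

lemma star_minus: "star (- x::'a::unital_cstar_algebra) = - star x"
  using star_add[of x "- x"] by (simp add: eq_neg_iff_add_eq_0 add.commute)

lemma star_diff: "star (x - y::'a::unital_cstar_algebra) = star x - star y"
  using star_add[of x "- y"] by (simp add: star_minus)

lemma star_one [simp]: "star (1::'a::unital_cstar_algebra) = 1"
  by (metis mult_1 mult_1_right star_mult star_star)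

lemma star_scaleR: "star (r *\<^sub>R x::'a::unital_cstar_algebra) = r *\<^sub>R star x"
  by (metis complex_cnj_complex_of_real scaleC_of_real star_scaleC)

lemma star_power: "star (x ^ n::'a::unital_cstar_algebra) = star x ^ n"
  by (induction n) (auto simp: star_mult power_commutes)

lemma norm_star [simp]: "norm (star (x::'a::unital_cstar_algebra)) = norm x"
proof -
  have le: "norm y \<le> norm (star y)" for y :: 'a
  proof (cases "y = 0")
    case False
    have "norm y * norm y \<le> norm (star y) * norm y"
      using cstar_identity[of y] norm_mult_ineq[of "star y" y] by (simp add: power2_eq_square)
    then show ?thesis using False by simp
  qed simp
  from le[of x] le[of "star x"] show ?thesis by (simp add: star_star)
qed

lemma tendsto_star:
  fixes f :: "'b \<Rightarrow> 'a::unital_cstar_algebra"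
  assumes "(f \<longlongrightarrow> l) F"
  shows "((\<lambda>x. star (f x)) \<longlongrightarrow> star l) F"
  using assms unfolding tendsto_iff dist_norm by (simp flip: star_diff)

text \<open>For a self-adjoint element the C*-identity says \<open>\<parallel>a\<^sup>2\<parallel> = \<parallel>a\<parallel>\<^sup>2\<close>. Iterating it
  along the powers of two is what ties the norm to the spectrum.\<close>

lemma norm_power_two_power:
  fixes a :: "'a::unital_cstar_algebra"
  assumes "star a = a"
  shows "norm (a ^ 2 ^ k) = norm a ^ 2 ^ k"
proof (induction k)
  case (Suc k)
  have "norm (a ^ 2 ^ Suc k) = norm (star (a ^ 2 ^ k) * a ^ 2 ^ k)"
    by (simp add: star_power assms mult_2 power_add)
  then show ?case
    by (simp add: cstar_identity Suc power_mult[symmetric] mult.commute)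
qed simp

lemma norm_power_eq_1:
  fixes a :: "'a::unital_cstar_algebra"
  assumes "star a = a" "norm a = 1"
  shows "norm (a ^ n) = 1"
proof (rule antisym)
  show "norm (a ^ n) \<le> 1" using norm_power_ineq[of a n] assms by simp
  have "n < 2 ^ n" by simp
  then have "a ^ 2 ^ n = a ^ n * a ^ (2 ^ n - n)" by (simp flip: power_add)
  then have "1 \<le> norm (a ^ n) * norm (a ^ (2 ^ n - n))"
    using norm_power_two_power[OF assms(1), of n] assms(2)
    by (metis norm_mult_ineq power_one)
  also have "\<dots> \<le> norm (a ^ n) * 1"
    using norm_power_ineq[of a "2 ^ n - n"] assms(2) by (intro mult_left_mono) auto
  finally show "1 \<le> norm (a ^ n)" by simp
qed

section \<open>Invertibility and the spectrum\<close>

lemma is_invertible_mult: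
  assumes "is_invertible (x::'a::monoid_mult)" "is_invertible y"
  shows "is_invertible (x * y)"
proof -
  obtain x' y' where "x * x' = 1" "x' * x = 1" "y * y' = 1" "y' * y = 1"
    using assms unfolding is_invertible_def by blast
  then have "(x * y) * (y' * x') = 1" "(y' * x') * (x * y) = 1"
    by (metis mult.assoc mult_1_right)+
  then show ?thesis unfolding is_invertible_def by blast
qed

lemma is_invertible_scaleC:
  fixes x :: "'a::unital_cstar_algebra"
  assumes "a \<noteq> 0"
  shows "is_invertible (a *\<^sub>C x) \<longleftrightarrow> is_invertible x"
proof -
  have *: "is_invertible (b *\<^sub>C y)" if b: "b \<noteq> 0" and "is_invertible y" for b and y :: 'a
  proof -
    obtain y' where "y * y' = 1" "y' * y = 1"
      using \<open>is_invertible y\<close> unfolding is_invertible_def by blast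
    then have "(b *\<^sub>C y) * (inverse b *\<^sub>C y') = 1" "(inverse b *\<^sub>C y') * (b *\<^sub>C y) = 1"
      using b by (auto simp: scaleC_mult_left scaleC_mult_right scaleC_scaleC)
    then show ?thesis unfolding is_invertible_def by blast
  qed
  from *[of a x] *[of "inverse a" "a *\<^sub>C x"] assms show ?thesis
    by (auto simp: scaleC_scaleC)
qed

lemma is_invertible_minus: "is_invertible (- x::'a::ring_1) \<longleftrightarrow> is_invertible x"
  unfolding is_invertible_def by (metis minus_mult_minus minus_minus)

lemma sum_powers_mult_one_minus:
  fixes x :: "'a::ring_1"
  shows "(\<Sum>i<n. x ^ i) * (1 - x) = 1 - x ^ n"
proof (induction n)
  case (Suc n)
  have "(\<Sum>i<Suc n. x ^ i) * (1 - x) = (1 - x ^ n) + x ^ n * (1 - x)"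
    by (simp add: distrib_right Suc)
  then show ?case by (simp add: right_diff_distrib power_commutes)
qed simp


lemma is_invertible_one_minus:
  fixes x :: "'a::{real_normed_algebra_1,banach}"
  assumes "norm x < 1"
  shows "is_invertible (1 - x)"
proof -
  have sm: "summable (\<lambda>n. x ^ n)" by (rule complete_algebra_summable_geometric[OF assms])
  define S where "S = (\<Sum>n. x ^ n)"
  have sh: "S = 1 + (\<Sum>n. x ^ Suc n)"
    using suminf_split_head[OF sm] unfolding S_def by simp
  have "(\<Sum>n. x ^ Suc n) = x * S" "(\<Sum>n. x ^ Suc n) = S * x"
    unfolding S_def using suminf_mult[OF sm, of x] suminf_mult2[OF sm, of x]
    by (simp_all add: power_commutes)
  with sh have "(1 - x) * S = 1" "S * (1 - x) = 1" by (auto simp: algebra_simps)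
  then show ?thesis unfolding is_invertible_def by blast
qed

lemma spectrum_norm_bound:
  fixes x :: "'a::unital_cstar_algebra"
  assumes "z \<in> spectrum x"
  shows "cmod z \<le> norm x"
proof (rule ccontr)
  assume "\<not> ?thesis"
  then have z: "norm x < cmod z" "z \<noteq> 0" by auto
  then have "is_invertible (1 - inverse z *\<^sub>C x)"
    by (intro is_invertible_one_minus) (use z in \<open>simp add: norm_scaleC norm_inverse norm_divide field_simps\<close>)
  then have "is_invertible (z *\<^sub>C (1 - inverse z *\<^sub>C x))"
    using z by (simp add: is_invertible_scaleC)
  then show False
    using assms z by (simp add: spectrum_def scaleC_diff_right scaleC_scaleC)
qed

lemma spectrum_add_scaleC:
  fixes x :: "'a::unital_cstar_algebra"
  shows "z \<in> spectrum (x + c *\<^sub>C 1) \<longleftrightarrow> z - c \<in> spectrum x"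
  by (simp add: spectrum_def scaleC_diff_left algebra_simps)

lemma spectrum_minus:
  fixes x :: "'a::unital_cstar_algebra"
  shows "z \<in> spectrum (- x) \<longleftrightarrow> - z \<in> spectrum x"
  using is_invertible_minus[of "z *\<^sub>C 1 + x"] by (simp add: spectrum_def)

lemma spectrum_scaleC:
  fixes x :: "'a::unital_cstar_algebra"
  assumes "c \<noteq> 0"
  shows "z \<in> spectrum (c *\<^sub>C x) \<longleftrightarrow> z / c \<in> spectrum x"
proof -
  have "z *\<^sub>C 1 - c *\<^sub>C x = c *\<^sub>C ((z / c) *\<^sub>C 1 - x)"
    using assms by (simp add: scaleC_diff_right scaleC_scaleC)
  then show ?thesis using assms by (simp add: spectrum_def is_invertible_scaleC)
qed

text \<open>Shifting \<open>a\<close> by the imaginary scalar \<open>\<i>t\<close> moves a spectral value \<open>\<alpha> + \<i>\<beta>\<close> to height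
  \<open>\<beta> + t\<close>, but \<open>\<parallel>a + \<i>t\<parallel>\<^sup>2 = \<parallel>a\<^sup>2 + t\<^sup>2\<parallel>\<close> grows only like \<open>t\<^sup>2\<close>; large \<open>t\<close> of the sign of \<open>\<beta>\<close>
  rule out \<open>\<beta> \<noteq> 0\<close>.\<close>

lemma spectrum_selfadjoint_real:
  fixes a :: "'a::unital_cstar_algebra"
  assumes sa: "star a = a" and z: "z \<in> spectrum a"
  shows "Im z = 0"
proof (rule ccontr)
  assume b: "Im z \<noteq> 0"
  have bound: "(Im z + t)\<^sup>2 \<le> (norm a)\<^sup>2 + t\<^sup>2" for t
  proof -
    let ?w = "a + (\<i> * t) *\<^sub>C 1"
    have "z + \<i> * t \<in> spectrum ?w" using z by (simp add: spectrum_add_scaleC)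
    then have "cmod (z + \<i> * t) \<le> norm ?w" by (rule spectrum_norm_bound)
    then have "(cmod (z + \<i> * t))\<^sup>2 \<le> norm (star ?w * ?w)"
      by (simp add: cstar_identity power_mono)
    moreover have "\<i> * of_real t * (\<i> * of_real t) = - (complex_of_real t * of_real t)"
      by (simp add: complex_eq_iff)
    then have "star ?w * ?w = a * a + (t\<^sup>2) *\<^sub>R 1"
      by (simp add: star_add star_scaleC sa distrib_left left_diff_distrib scaleC_diff_right scaleC_mult_left
          scaleC_mult_right scaleC_scaleC power2_eq_square flip: scaleC_of_real)
    moreover have "norm (a * a + (t\<^sup>2) *\<^sub>R 1) \<le> (norm a)\<^sup>2 + t\<^sup>2"
      using norm_triangle_ineq[of "a * a" "(t\<^sup>2) *\<^sub>R 1"] cstar_identity[of a] sa by simp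
    moreover have "(Im z + t)\<^sup>2 \<le> (cmod (z + \<i> * t))\<^sup>2" by (simp add: cmod_power2)
    ultimately show ?thesis by simp
  qed
  have "(Im z)\<^sup>2 + 2 * Im z * t \<le> (norm a)\<^sup>2" for t
    using bound[of t] by (simp add: power2_sum)
  from this[of "((norm a)\<^sup>2) / Im z"] b show False
    by (simp add: power2_eq_square)
       (smt (verit) mult_nonneg_nonneg norm_ge_zero not_real_square_gt_zero)
qed

text \<open>For an \<open>n\<close>-th root of unity \<open>\<omega>\<close>, \<open>1 - u\<^sup>n\<close> divided by \<open>1 - \<omega>u\<close> is the geometric sum of the
  \<open>(\<omega>u)\<^sup>j\<close> with \<open>j < n\<close>. Summing over all \<open>\<omega>\<close> cancels every term except \<open>j = 0\<close>.\<close>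

lemma roots_of_unity_resolvent_average:
  fixes u :: "'a::unital_cstar_algebra" and R :: "complex \<Rightarrow> 'a"
  assumes n: "n > 0"
    and R: "\<And>k. k < n \<Longrightarrow> (1 - (cis (2 * pi / n) ^ k) *\<^sub>C u) * R (cis (2 * pi / n) ^ k) = 1"
  shows "(1 - u ^ n) * ((1 / real n) *\<^sub>R (\<Sum>k<n. R (cis (2 * pi / n) ^ k))) = 1"
proof -
  define w where "w = cis (2 * pi / n)"
  have wn: "w ^ n = 1" using n by (simp add: w_def Complex.DeMoivre)
  have step: "(1 - u ^ n) * R (w ^ k) = (\<Sum>j<n. (w ^ k) ^ j *\<^sub>C u ^ j)" if "k < n" for k
  proof -
    have "1 - u ^ n = 1 - ((w ^ k) *\<^sub>C u) ^ n"
      by (simp add: scaleC_power flip: power_mult) (simp add: mult.commute[of k] power_mult wn)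
    also have "\<dots> = (\<Sum>j<n. ((w ^ k) *\<^sub>C u) ^ j) * (1 - (w ^ k) *\<^sub>C u)"
      by (simp add: sum_powers_mult_one_minus)
    finally show ?thesis using R[OF that] by (simp add: w_def mult.assoc scaleC_power)
  qed
  have root_sum: "(\<Sum>k<n. (w ^ k) ^ j) = (if j = 0 then of_nat n else 0)" if "j < n" for j
  proof (cases "j = 0")
    case False
    have "w ^ j \<noteq> 1"
    proof
      assume "w ^ j = 1"
      then have "exp (2 * of_real pi * \<i> * of_nat j / of_nat n) = 1"
        by (simp add: w_def Complex.DeMoivre) (simp add: cis_conv_exp mult_ac)
      then show False using complex_root_unity_eq_1[of n j] n that False
        by (auto dest: dvd_imp_le)
    qed
    moreover have "(w ^ j) ^ n = 1" by (metis wn power_mult mult.commute power_one)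
    ultimately have "(\<Sum>k<n. (w ^ j) ^ k) = 0" by (simp add: geometric_sum)
    then show ?thesis using False by (simp add: mult.commute flip: power_mult)
  qed simp
  have "(1 - u ^ n) * (\<Sum>k<n. R (w ^ k)) = (\<Sum>k<n. \<Sum>j<n. (w ^ k) ^ j *\<^sub>C u ^ j)"
    by (simp add: sum_distrib_left step)
  also have "\<dots> = (\<Sum>j<n. (\<Sum>k<n. (w ^ k) ^ j) *\<^sub>C u ^ j)"
    by (subst sum.swap) (simp add: scaleC_sum_left)
  also have "\<dots> = (\<Sum>j<n. if j = 0 then of_nat n *\<^sub>C 1 else 0)"
    by (intro sum.cong) (auto simp: root_sum)
  also have "\<dots> = real n *\<^sub>R 1" using n by (simp flip: scaleC_of_real)
  finally show ?thesis using n by (simp add: w_def)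
qed

text \<open>The inverses \<open>R \<lambda>\<close> of \<open>1 - \<lambda>u\<close> vary continuously by the resolvent identity
  \<open>R \<lambda> - R \<mu> = (\<lambda> - \<mu>) R \<lambda> u R \<mu>\<close>, which first yields a local bound on \<open>R\<close> and
  then its continuity.\<close>

lemma resolvent_continuous_on:
  fixes u :: "'a::unital_cstar_algebra" and R :: "complex \<Rightarrow> 'a"
  assumes R: "\<And>l. l \<in> D \<Longrightarrow> (1 - l *\<^sub>C u) * R l = 1 \<and> R l * (1 - l *\<^sub>C u) = 1"
  shows "continuous_on D R"
  unfolding continuous_on_iff
proof (intro ballI allI impI)
  fix m and e :: real assume m: "m \<in> D" and e: "e > 0"
  have ident: "R l - R m = (l - m) *\<^sub>C (R l * (u * R m))" if "l \<in> D" for l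
  proof -
    have "(l - m) *\<^sub>C (R l * (u * R m)) = R l * ((1 - m *\<^sub>C u) - (1 - l *\<^sub>C u)) * R m"
      by (simp add: scaleC_diff_left algebra_simps scaleC_mult_left scaleC_mult_right)
    also have "\<dots> = R l * ((1 - m *\<^sub>C u) * R m) - (R l * (1 - l *\<^sub>C u)) * R m"
      by (simp only: right_diff_distrib left_diff_distrib mult.assoc)
    also have "\<dots> = R l - R m" using R[OF that] R[OF m] by simp
    finally show ?thesis by simp
  qed
  define K where "K = norm (u * R m) + 1"
  define B where "B = norm (R m) + 1"
  have K: "K > 0" "norm (u * R m) \<le> K" and B: "B > 0" "norm (R m) \<le> B"
    by (auto simp: K_def B_def add_nonneg_pos)
  define d where "d = min (1 / (2 * K)) (e / (4 * B * K))"
  have "d > 0" using K B e by (simp add: d_def)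
  moreover have "dist (R l) (R m) < e" if l: "l \<in> D" and ld: "dist l m < d" for l
  proof -
    have est: "norm (R l - R m) \<le> cmod (l - m) * (norm (R l) * K)"
    proof -
      have "norm (R l - R m) = cmod (l - m) * norm (R l * (u * R m))"
        by (simp add: ident[OF l] norm_scaleC)
      also have "\<dots> \<le> cmod (l - m) * (norm (R l) * norm (u * R m))"
        by (intro mult_left_mono norm_mult_ineq) auto
      also have "\<dots> \<le> cmod (l - m) * (norm (R l) * K)"
        using K by (intro mult_left_mono) auto
      finally show ?thesis .
    qed
    have c1: "cmod (l - m) * K \<le> 1 / 2" and c2: "cmod (l - m) < e / (4 * B * K)"
      using ld K by (auto simp: d_def dist_norm field_simps)
    have "cmod (l - m) * (norm (R l) * K) \<le> norm (R l) / 2"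
      using mult_left_mono[OF c1, of "norm (R l)"] by (simp add: mult_ac)
    with est have "norm (R l - R m) \<le> norm (R l) / 2" by simp
    then have bl: "norm (R l) \<le> 2 * B"
      using norm_triangle_ineq[of "R l - R m" "R m"] B(2) by simp
    have "cmod (l - m) * (norm (R l) * K) \<le> e / (4 * B * K) * (2 * B * K)"
      using mult_mono[of "cmod (l - m)" "e / (4 * B * K)" "norm (R l) * K" "2 * B * K"] bl c2 K B e by simp
    also have "\<dots> = e / 2" using K B by simp
    also have "\<dots> < e" using e by simp
    finally show ?thesis using est by (simp add: dist_norm)
  qed
  ultimately show "\<exists>d>0. \<forall>l\<in>D. dist l m < d \<longrightarrow> dist (R l) (R m) < e" by blast
qed

text \<open>The spectral radius formula for self-adjoint elements. Otherwise \<open>1 - \<lambda>u\<close> would be invertible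
  for all \<open>\<lambda>\<close> in the closed unit disc. The averages of the inverses over \<open>n\<close> equidistant points of the
  circle of radius \<open>r\<close> invert \<open>1 - (ru)\<^sup>n\<close>: for \<open>r < 1\<close> they converge to \<open>1\<close> as \<open>n\<close> grows, and by
  uniform continuity the averages for \<open>r = 1\<close> stay close to them. This forces \<open>u\<^sup>n\<close> to become
  small although \<open>\<parallel>u\<^sup>n\<parallel> = 1\<close>.\<close>

lemma spectrum_selfadjoint_norm_1:
  fixes u :: "'a::unital_cstar_algebra"
  assumes sa: "star u = u" and nu: "norm u = 1"
  shows "1 \<in> spectrum u \<or> -1 \<in> spectrum u"
proof (rule ccontr)
  assume no: "\<not> ?thesis"
  have "is_invertible (1 - l *\<^sub>C u)" if l: "cmod l \<le> 1" for l
  proof (cases "cmod l < 1")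
    case True
    then show ?thesis by (intro is_invertible_one_minus) (simp add: norm_scaleC nu)
  next
    case False
    with l have l1: "cmod l = 1" by simp
    have "inverse l \<notin> spectrum u"
    proof
      assume il: "inverse l \<in> spectrum u"
      have real_unit: "z = 1 \<or> z = -1" if "Im z = 0" "cmod z = 1" for z
        using that by (auto simp: complex_eq_iff cmod_def)
      have "inverse l = 1 \<or> inverse l = -1"
        using spectrum_selfadjoint_real[OF sa il] l1 by (intro real_unit) (auto simp: norm_inverse)
      then show False using il no by auto
    qed
    moreover have "l \<noteq> 0" using l1 by auto
    moreover from this have "1 - l *\<^sub>C u = l *\<^sub>C (inverse l *\<^sub>C 1 - u)"
      by (simp add: scaleC_diff_right scaleC_scaleC)
    ultimately show ?thesis by (simp add: spectrum_def is_invertible_scaleC)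
  qed
  then have "\<forall>l\<in>cball 0 1. \<exists>y. (1 - l *\<^sub>C u) * y = 1 \<and> y * (1 - l *\<^sub>C u) = 1"
    unfolding is_invertible_def by (simp add: dist_norm)
  then obtain R where R: "\<And>l. l \<in> cball 0 1 \<Longrightarrow> (1 - l *\<^sub>C u) * R l = 1 \<and> R l * (1 - l *\<^sub>C u) = 1"
    by metis
  have cont: "continuous_on (cball 0 1) R" by (rule resolvent_continuous_on[OF R])
  then have "uniformly_continuous_on (cball 0 1) R"
    by (intro compact_uniformly_continuous) auto
  then obtain d where d: "d > 0"
    "\<And>l m. l \<in> cball 0 1 \<Longrightarrow> m \<in> cball 0 1 \<Longrightarrow> dist l m < d \<Longrightarrow> dist (R l) (R m) < 1/8"
    using uniformly_continuous_onE[of "cball 0 1" R "1/8"] by (auto simp: dist_commute)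
  have "bounded (R ` cball 0 1)"
    using cont by (intro compact_imp_bounded compact_continuous_image) auto
  then obtain M where M: "M > 0" "\<And>l. l \<in> cball 0 1 \<Longrightarrow> norm (R l) \<le> M"
    unfolding bounded_pos by auto
  define r where "r = max 0 (1 - d / 2)"
  have r: "0 \<le> r" "r < 1" "1 - r < d" using d(1) by (auto simp: r_def)
  obtain n where n: "n > 0" "r ^ n * M < 1/8"
  proof -
    have "(\<lambda>n. r ^ n * M) \<longlonglongrightarrow> 0" using r by (intro tendsto_mult_left_zero LIMSEQ_power_zero) auto
    then have "eventually (\<lambda>n. r ^ n * M < 1/8) sequentially" by (rule order_tendstoD) simp
    then obtain N where "\<forall>n\<ge>N. r ^ n * M < 1/8" by (auto simp: eventually_sequentially)
    then have "r ^ Suc N * M < 1/8" using le_SucI by blast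
    then show thesis by (intro that[of "Suc N"]) auto
  qed
  define w where "w = cis (2 * pi / n)"
  have w1: "cmod (w ^ k) = 1" for k by (simp add: w_def norm_power)
  define S where "S = (1 / real n) *\<^sub>R (\<Sum>k<n. R (w ^ k))"
  define S' where "S' = (1 / real n) *\<^sub>R (\<Sum>k<n. R (of_real r * w ^ k))"
  have S: "(1 - u ^ n) * S = 1"
    unfolding S_def w_def using R w1 n by (intro roots_of_unity_resolvent_average) (auto simp: w_def)
  have S': "(1 - (r *\<^sub>R u) ^ n) * S' = 1"
    unfolding S'_def w_def using R w1 n r
    by (intro roots_of_unity_resolvent_average[where R = "\<lambda>l. R (of_real r * l)"])
       (auto simp: w_def norm_mult scaleC_scaleC mult.commute simp flip: scaleC_of_real)
  have avg: "norm ((1 / real n) *\<^sub>R (\<Sum>k<n. f k)) \<le> B" if "\<And>k. k < n \<Longrightarrow> norm (f k) \<le> B"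
    for f :: "nat \<Rightarrow> 'a" and B
    using sum_norm_le[of "{..<n}" f "\<lambda>_. B"] that n by (simp add: field_simps)
  have "norm S' \<le> M"
    unfolding S'_def using r by (intro avg M(2)) (auto simp: norm_mult w1)
  moreover have "S' - 1 = (r *\<^sub>R u) ^ n * S'" using S' by (simp add: algebra_simps)
  moreover have "norm ((r *\<^sub>R u) ^ n) \<le> r ^ n"
    using norm_power_ineq[of "r *\<^sub>R u" n] nu r by simp
  ultimately have "norm (S' - 1) \<le> r ^ n * M"
    using r norm_mult_ineq[of "(r *\<^sub>R u) ^ n" S']
      mult_mono[of "norm ((r *\<^sub>R u) ^ n)" "r ^ n" "norm S'" M] by simp
  moreover have "norm (S - S') \<le> 1/8"
  proof -
    have "S - S' = (1 / real n) *\<^sub>R (\<Sum>k<n. R (w ^ k) - R (of_real r * w ^ k))"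
      by (simp add: S_def S'_def sum_subtractf algebra_simps)
    moreover have "norm (R (w ^ k) - R (of_real r * w ^ k)) \<le> 1/8" for k
    proof -
      have "w ^ k - of_real r * w ^ k = of_real (1 - r) * w ^ k" by (simp add: algebra_simps)
      then have "dist (w ^ k) (of_real r * w ^ k) = \<bar>1 - r\<bar>"
        by (simp only: dist_norm norm_mult w1 norm_of_real) simp
      then have "dist (R (w ^ k)) (R (of_real r * w ^ k)) < 1/8"
        using r by (intro d(2)) (auto simp: norm_mult w1)
      then show ?thesis by (simp add: dist_norm)
    qed
    ultimately show ?thesis by (simp only: avg)
  qed
  ultimately have S1: "norm (S - 1) < 1/4"
    using n norm_triangle_ineq[of "S - S'" "S' - 1"] by simp
  have "u ^ n = (S - 1) - u ^ n * (S - 1)"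
    using S by (simp add: algebra_simps)
  then have "norm (u ^ n) \<le> norm (S - 1) + norm (u ^ n * (S - 1))"
    by (metis norm_triangle_ineq4)
  also have "\<dots> \<le> norm (S - 1) + norm (u ^ n) * norm (S - 1)"
    by (intro add_left_mono norm_mult_ineq)
  finally have "norm (u ^ n) \<le> norm (S - 1) + norm (u ^ n) * norm (S - 1)" .
  then show False using S1 norm_power_eq_1[OF sa nu, of n] by simp
qed

section \<open>Polynomials in a self-adjoint element\<close>

lemma spectrum_selfadjoint_norm:
  fixes a :: "'a::unital_cstar_algebra"
  assumes sa: "star a = a"
  shows "\<exists>s. \<bar>s\<bar> = norm a \<and> complex_of_real s \<in> spectrum a"
proof (cases "a = 0")
  case True
  then have "complex_of_real 0 \<in> spectrum a" by (simp add: spectrum_def is_invertible_def)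
  then show ?thesis using True by (intro exI[of _ 0]) auto
next
  case False
  define u where "u = (1 / norm a) *\<^sub>R a"
  have "star u = u" "norm u = 1" using False sa by (auto simp: u_def star_scaleR)
  then have "1 \<in> spectrum u \<or> -1 \<in> spectrum u" by (rule spectrum_selfadjoint_norm_1)
  then obtain e :: real where e: "\<bar>e\<bar> = 1" "complex_of_real e \<in> spectrum u"
    using that[of 1] that[of "-1"] by auto
  have "a = complex_of_real (norm a) *\<^sub>C u" using False by (simp add: u_def scaleC_of_real)
  then have "complex_of_real (e * norm a) \<in> spectrum a"
    using e False spectrum_scaleC[of "complex_of_real (norm a)" "complex_of_real (e * norm a)" u] by simp
  then show ?thesis using e by (intro exI[of _ "e * norm a"]) (simp add: abs_mult)
qed

definition poly_apply :: "complex poly \<Rightarrow> 'a::unital_cstar_algebra \<Rightarrow> 'a" where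
  "poly_apply P a = fold_coeffs (\<lambda>c y. c *\<^sub>C 1 + a * y) P 0"

lemma poly_apply_0 [simp]: "poly_apply 0 a = 0"
  by (simp add: poly_apply_def)

lemma poly_apply_pCons [simp]: "poly_apply (pCons c P) a = c *\<^sub>C 1 + a * poly_apply P a"
  by (cases "P = 0 \<and> c = 0") (auto simp: poly_apply_def)

lemma poly_apply_add: "poly_apply (P + Q) a = poly_apply P a + poly_apply Q a"
  by (induction P Q rule: poly_induct2) (auto simp: scaleC_add_left algebra_simps)

lemma poly_apply_smult: "poly_apply (smult c P) a = c *\<^sub>C poly_apply P a"
  by (induction P) (auto simp: scaleC_add_right scaleC_scaleC scaleC_mult_right)

lemma poly_apply_mult: "poly_apply (P * Q) a = poly_apply P a * poly_apply Q a"
  by (induction P)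
     (auto simp: poly_apply_add poly_apply_smult distrib_right scaleC_mult_left mult.assoc)

text \<open>A product of invertible elements is invertible, so if \<open>P(a)\<close> is not invertible, then neither is
  \<open>a - r\<close> for some linear factor \<open>X - r\<close> of \<open>P\<close>; its root \<open>r\<close> lies in the spectrum.\<close>

lemma not_invertible_poly_apply_root:
  fixes a :: "'a::unital_cstar_algebra"
  assumes "P \<noteq> 0" "\<not> is_invertible (poly_apply P a)"
  shows "\<exists>z\<in>spectrum a. poly P z = 0"
  using assms
proof (induction "degree P" arbitrary: P)
  case 0
  then obtain c where c: "P = [:c:]" "c \<noteq> 0" by (metis degree_eq_zeroE pCons_0_0)
  moreover have "is_invertible (1::'a)" unfolding is_invertible_def by auto
  ultimately show ?case using 0(3) by (simp add: is_invertible_scaleC)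
next
  case (Suc n)
  obtain r where r: "poly P r = 0"
    using alg_closed_imp_poly_has_root[of P] by (metis Suc.hyps(2) zero_less_Suc)
  then obtain Q where Q: "P = [:- r, 1:] * Q" unfolding poly_eq_0_iff_dvd by (rule dvdE)
  show ?case
  proof (cases "r \<in> spectrum a")
    case False
    then have "is_invertible (- (r *\<^sub>C 1 - a))"
      unfolding is_invertible_minus by (simp add: spectrum_def)
    then have "is_invertible (poly_apply [:- r, 1:] a)" by (simp add: algebra_simps)
    moreover have "\<not> is_invertible (poly_apply [:- r, 1:] a * poly_apply Q a)"
      using Suc.prems(2) unfolding Q poly_apply_mult .
    ultimately have "\<not> is_invertible (poly_apply Q a)" using is_invertible_mult by blast
    moreover have Q0: "Q \<noteq> 0" using Suc.prems(1) unfolding Q by (metis mult_zero_right)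
    moreover have "degree P = degree [:- r, 1:] + degree Q"
      unfolding Q by (rule degree_mult_eq) (use Q0 in simp_all)
    then have "n = degree Q" using Suc.hyps(2) by simp
    ultimately obtain z where "z \<in> spectrum a" "poly Q z = 0" using Suc.hyps(1) by blast
    then show ?thesis unfolding Q poly_mult by (intro bexI[of _ z]) simp_all
  qed (use r in \<open>rule bexI\<close>)
qed

lemma spectrum_poly_apply:
  fixes a :: "'a::unital_cstar_algebra"
  assumes sa: "star a = a" and "z \<in> spectrum (poly_apply P a)"
  shows "z \<in> poly P ` spectrum a"
proof (cases "P = [:z:]")
  case True
  then show ?thesis using spectrum_selfadjoint_norm[OF sa] by auto
next
  case False
  have "poly_apply (P - [:z:]) a = - (z *\<^sub>C 1 - poly_apply P a)"
    using poly_apply_add[of "P - [:z:]" "[:z:]" a] by (simp add: algebra_simps)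
  then have "\<not> is_invertible (poly_apply (P - [:z:]) a)"
    using assms by (simp only: is_invertible_minus spectrum_def mem_Collect_eq) simp
  moreover have "P - [:z:] \<noteq> 0" using False by simp
  ultimately obtain w where "w \<in> spectrum a" "poly (P - [:z:]) w = 0"
    using not_invertible_poly_apply_root by blast
  then show ?thesis by auto
qed

definition real_poly_apply :: "real poly \<Rightarrow> 'a::unital_cstar_algebra \<Rightarrow> 'a" where
  "real_poly_apply P a = poly_apply (map_poly complex_of_real P) a"

lemma real_poly_apply_0 [simp]: "real_poly_apply 0 a = 0"
  by (simp add: real_poly_apply_def)

lemma real_poly_apply_pCons [simp]: "real_poly_apply (pCons c P) a = c *\<^sub>R 1 + a * real_poly_apply P a"
  by (simp add: real_poly_apply_def map_poly_pCons scaleC_of_real)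

lemma real_poly_apply_add: "real_poly_apply (P + Q) a = real_poly_apply P a + real_poly_apply Q a"
  by (induction P Q rule: poly_induct2) (auto simp: algebra_simps)

lemma real_poly_apply_smult: "real_poly_apply (smult c P) a = c *\<^sub>R real_poly_apply P a"
  by (induction P) (auto simp: algebra_simps)

lemma real_poly_apply_diff: "real_poly_apply (P - Q) a = real_poly_apply P a - real_poly_apply Q a"
  using real_poly_apply_add[of "P - Q" Q a] by simp

lemma real_poly_apply_mult: "real_poly_apply (P * Q) a = real_poly_apply P a * real_poly_apply Q a"
  by (induction P)
     (auto simp: real_poly_apply_add real_poly_apply_smult distrib_right mult.assoc)

lemma real_poly_apply_power: "real_poly_apply (P ^ n) a = real_poly_apply P a ^ n"
  by (induction n) (auto simp: real_poly_apply_mult one_pCons)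

lemma real_poly_apply_commute:
  assumes "a * b = b * a"
  shows "real_poly_apply P a * b = b * real_poly_apply P a"
proof (induction P)
  case (pCons c P)
  have "a * (real_poly_apply P a * b) = b * (a * real_poly_apply P a)"
    by (metis assms mult.assoc pCons.IH)
  then show ?case by (simp add: distrib_left distrib_right mult.assoc)
qed simp

lemma star_real_poly_apply:
  assumes "star a = a"
  shows "star (real_poly_apply P a) = real_poly_apply P a"
proof (induction P)
  case (pCons c P)
  have "star (a * real_poly_apply P a) = real_poly_apply P a * a"
    by (simp add: star_mult assms pCons.IH)
  also have "\<dots> = a * real_poly_apply P a" by (rule real_poly_apply_commute) simp
  finally show ?case by (simp add: star_add star_scaleR)
qed simp

lemma spectrum_real_poly_apply:
  fixes a :: "'a::unital_cstar_algebra"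
  assumes sa: "star a = a" and z: "z \<in> spectrum (real_poly_apply P a)"
  shows "\<exists>t. complex_of_real t \<in> spectrum a \<and> z = complex_of_real (poly P t)"
proof -
  have pm: "poly (map_poly complex_of_real P) (of_real t) = of_real (poly P t)" for t
    by (induction P) (auto simp: map_poly_pCons)
  obtain w where w: "w \<in> spectrum a" "z = poly (map_poly complex_of_real P) w"
    using spectrum_poly_apply[OF sa] z unfolding real_poly_apply_def by blast
  have "w = complex_of_real (Re w)"
    using spectrum_selfadjoint_real[OF sa w(1)] by (simp add: complex_eq_iff)
  then show ?thesis using w pm by metis
qed

text \<open>\<open>P(a)\<close> is self-adjoint, so its norm is attained on its spectrum, which consists of values of \<open>P\<close>
  on the spectrum of \<open>a\<close>. Norms of polynomials in \<open>a\<close> are thereby estimated by calculus on the real line.\<close>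

lemma norm_real_poly_apply_le:
  fixes a :: "'a::unital_cstar_algebra"
  assumes sa: "star a = a"
    and B: "\<And>t. complex_of_real t \<in> spectrum a \<Longrightarrow> \<bar>poly P t\<bar> \<le> B"
  shows "norm (real_poly_apply P a) \<le> B"
proof -
  obtain s where s: "\<bar>s\<bar> = norm (real_poly_apply P a)"
      "complex_of_real s \<in> spectrum (real_poly_apply P a)"
    using spectrum_selfadjoint_norm[OF star_real_poly_apply[OF sa]] by blast
  then show ?thesis using spectrum_real_poly_apply[OF sa s(2)] B by (metis of_real_eq_iff)
qed

section \<open>The positive cone\<close>

lemma pos_cone_selfadjoint: "x \<in> pos_cone \<Longrightarrow> star x = x"
  by (simp add: pos_cone_def)

lemma pos_cone_spectrum_nonneg: "x \<in> pos_cone \<Longrightarrow> complex_of_real t \<in> spectrum x \<Longrightarrow> 0 \<le> t"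
  by (auto simp: pos_cone_def)

lemma real_spectrum_le_norm:
  "complex_of_real t \<in> spectrum x \<Longrightarrow> \<bar>t\<bar> \<le> norm (x::'a::unital_cstar_algebra)"
  using spectrum_norm_bound[of "complex_of_real t" x] by simp

lemma pos_coneI:
  fixes x :: "'a::unital_cstar_algebra"
  assumes "star x = x" "\<And>t. complex_of_real t \<in> spectrum x \<Longrightarrow> 0 \<le> t"
  shows "x \<in> pos_cone"
proof -
  have "\<exists>r\<ge>0. z = complex_of_real r" if "z \<in> spectrum x" for z
  proof -
    have "z = complex_of_real (Re z)"
      using spectrum_selfadjoint_real[OF assms(1) that] by (simp add: complex_eq_iff)
    then show ?thesis using assms(2) that by metis
  qed
  then show ?thesis using assms(1) by (simp add: pos_cone_def)
qed

lemma spectrum_scalar_minus: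
  fixes x :: "'a::unital_cstar_algebra"
  shows "complex_of_real t \<in> spectrum (s *\<^sub>R 1 - x) \<longleftrightarrow> complex_of_real (s - t) \<in> spectrum x"
  using spectrum_add_scaleC[of "complex_of_real t" "- x" "complex_of_real s"]
    spectrum_minus[of "complex_of_real (t - s)" x]
  by (simp add: scaleC_of_real)

lemma norm_le_spectrum:
  fixes a :: "'a::unital_cstar_algebra"
  assumes "star a = a" "\<And>t. complex_of_real t \<in> spectrum a \<Longrightarrow> \<bar>t\<bar> \<le> B"
  shows "norm a \<le> B"
  using spectrum_selfadjoint_norm[OF assms(1)] assms(2) by metis

text \<open>Positivity is a condition on norms; this is why sums and limits of positive elements are
  positive, which the spectral definition does not show.\<close>

lemma pos_cone_iff_norm:
  fixes a :: "'a::unital_cstar_algebra"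
  assumes sa: "star a = a" and s: "norm a \<le> s"
  shows "a \<in> pos_cone \<longleftrightarrow> norm (s *\<^sub>R 1 - a) \<le> s"
proof
  assume a: "a \<in> pos_cone"
  show "norm (s *\<^sub>R 1 - a) \<le> s"
  proof (rule norm_le_spectrum)
    show "star (s *\<^sub>R 1 - a) = s *\<^sub>R 1 - a" by (simp add: star_diff star_scaleR sa)
    fix t assume "complex_of_real t \<in> spectrum (s *\<^sub>R 1 - a)"
    then have "complex_of_real (s - t) \<in> spectrum a" by (simp only: spectrum_scalar_minus)
    then show "\<bar>t\<bar> \<le> s"
      using pos_cone_spectrum_nonneg[OF a, of "s - t"] real_spectrum_le_norm[of "s - t" a] s by linarith
  qed
next
  assume n: "norm (s *\<^sub>R 1 - a) \<le> s"
  show "a \<in> pos_cone"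
  proof (rule pos_coneI[OF sa])
    fix t assume "complex_of_real t \<in> spectrum a"
    then have "complex_of_real (s - t) \<in> spectrum (s *\<^sub>R 1 - a)"
      unfolding spectrum_scalar_minus by simp
    then have "\<bar>s - t\<bar> \<le> norm (s *\<^sub>R 1 - a)" by (rule real_spectrum_le_norm)
    then show "0 \<le> t" using n by linarith
  qed
qed

lemma pos_cone_add:
  fixes a b :: "'a::unital_cstar_algebra"
  assumes a: "a \<in> pos_cone" and b: "b \<in> pos_cone"
  shows "a + b \<in> pos_cone"
proof -
  have sa: "star a = a" "star b = b" using a b by (auto simp: pos_cone_selfadjoint)
  have eq: "(norm a + norm b) *\<^sub>R 1 - (a + b) = (norm a *\<^sub>R 1 - a) + (norm b *\<^sub>R 1 - b)"
    by (simp add: algebra_simps)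
  have "norm (norm a *\<^sub>R 1 - a) \<le> norm a" "norm (norm b *\<^sub>R 1 - b) \<le> norm b"
    using a b pos_cone_iff_norm[of a "norm a"] pos_cone_iff_norm[of b "norm b"] sa by blast+
  then have "norm ((norm a + norm b) *\<^sub>R 1 - (a + b)) \<le> norm a + norm b"
    unfolding eq using norm_triangle_ineq[of "norm a *\<^sub>R 1 - a" "norm b *\<^sub>R 1 - b"] by linarith
  moreover have "star (a + b) = a + b" by (simp add: star_add sa)
  ultimately show ?thesis
    using pos_cone_iff_norm[OF _ norm_triangle_ineq[of a b]] by blast
qed

lemma pos_cone_scaleR:
  fixes a :: "'a::unital_cstar_algebra"
  assumes "a \<in> pos_cone" "0 \<le> r"
  shows "r *\<^sub>R a \<in> pos_cone"
proof -
  have sa: "star a = a" using assms by (simp add: pos_cone_selfadjoint)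
  have "norm (norm a *\<^sub>R 1 - a) \<le> norm a"
    using assms(1) pos_cone_iff_norm[OF sa order_refl] by blast
  then have "norm (r *\<^sub>R (norm a *\<^sub>R 1 - a)) \<le> r * norm a"
    using assms by (simp add: mult_left_mono)
  moreover have "r *\<^sub>R (norm a *\<^sub>R 1 - a) = (r * norm a) *\<^sub>R 1 - r *\<^sub>R a"
    by (simp add: scaleR_right_diff_distrib)
  moreover have "star (r *\<^sub>R a) = r *\<^sub>R a" "norm (r *\<^sub>R a) \<le> r * norm a"
    using assms(2) by (simp_all add: star_scaleR sa)
  ultimately show ?thesis using pos_cone_iff_norm by metis
qed

lemma pos_cone_square:
  fixes a :: "'a::unital_cstar_algebra"
  assumes "star a = a"
  shows "a * a \<in> pos_cone"
proof (rule pos_coneI)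
  show "star (a * a) = a * a" by (simp add: star_mult assms)
  fix t assume "complex_of_real t \<in> spectrum (a * a)"
  then have "complex_of_real t \<in> spectrum (real_poly_apply [:0, 0, 1:] a)" by simp
  then obtain s where "complex_of_real t = complex_of_real (poly [:0, 0, 1:] s)"
    using spectrum_real_poly_apply[OF assms] by blast
  then show "0 \<le> t" by (simp only: of_real_eq_iff) simp
qed

lemma pos_cone_antisym:
  fixes a :: "'a::unital_cstar_algebra"
  assumes "a \<in> pos_cone" "- a \<in> pos_cone"
  shows "a = 0"
proof -
  have "norm a \<le> 0"
  proof (rule norm_le_spectrum)
    show "star a = a" using assms by (simp add: pos_cone_selfadjoint)
    fix t assume t: "complex_of_real t \<in> spectrum a"
    then have "complex_of_real (- t) \<in> spectrum (- a)" by (simp add: spectrum_minus)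
    then show "\<bar>t\<bar> \<le> 0"
      using pos_cone_spectrum_nonneg[OF assms(1) t] pos_cone_spectrum_nonneg[OF assms(2), of "- t"] by simp
  qed
  then show ?thesis by simp
qed

lemma scalar_minus_pos_cone:
  fixes a :: "'a::unital_cstar_algebra"
  assumes sa: "star a = a" and "norm a \<le> s"
  shows "s *\<^sub>R 1 - a \<in> pos_cone"
proof (rule pos_coneI)
  show "star (s *\<^sub>R 1 - a) = s *\<^sub>R 1 - a" by (simp add: star_diff star_scaleR sa)
  fix t assume "complex_of_real t \<in> spectrum (s *\<^sub>R 1 - a)"
  then have "complex_of_real (s - t) \<in> spectrum a" by (simp only: spectrum_scalar_minus)
  then have "\<bar>s - t\<bar> \<le> norm a" by (rule real_spectrum_le_norm)
  then show "0 \<le> t" using assms(2) by linarith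
qed

lemma norm_mem_spectrum:
  fixes a :: "'a::unital_cstar_algebra"
  assumes "a \<in> pos_cone"
  shows "complex_of_real (norm a) \<in> spectrum a"
  using spectrum_selfadjoint_norm[OF pos_cone_selfadjoint[OF assms]]
    pos_cone_spectrum_nonneg[OF assms] by (metis abs_of_nonneg)

lemma norm_le_if_scalar_minus_pos:
  fixes a :: "'a::unital_cstar_algebra"
  assumes "a \<in> pos_cone" "s *\<^sub>R 1 - a \<in> pos_cone"
  shows "norm a \<le> s"
proof -
  have "complex_of_real (s - norm a) \<in> spectrum (s *\<^sub>R 1 - a)"
    using norm_mem_spectrum[OF assms(1)] by (simp only: spectrum_scalar_minus) simp
  then show ?thesis using pos_cone_spectrum_nonneg[OF assms(2), of "s - norm a"] by simp
qed

lemma norm_mono_pos_cone: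
  fixes a b :: "'a::unital_cstar_algebra"
  assumes "a \<in> pos_cone" "b - a \<in> pos_cone"
  shows "norm a \<le> norm b"
proof (rule norm_le_if_scalar_minus_pos[OF assms(1)])
  have "b \<in> pos_cone" using pos_cone_add[OF assms] by simp
  then have "norm b *\<^sub>R 1 - b \<in> pos_cone"
    by (simp add: scalar_minus_pos_cone pos_cone_selfadjoint)
  from pos_cone_add[OF this assms(2)] show "norm b *\<^sub>R 1 - a \<in> pos_cone" by simp
qed

lemma norm_diff_le_1:
  fixes x y :: "'a::unital_cstar_algebra"
  assumes x: "x \<in> pos_cone" "norm x \<le> 1" and y: "y \<in> pos_cone" "norm y \<le> 1"
  shows "norm (x - y) \<le> 1"
proof (rule norm_le_spectrum)
  have sa: "star x = x" "star y = y" using x y by (auto simp: pos_cone_selfadjoint)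
  show sad: "star (x - y) = x - y" by (simp add: star_diff sa)
  have pos: "1 *\<^sub>R 1 - (u - v) \<in> pos_cone"
    if "u \<in> pos_cone" "norm u \<le> 1" "v \<in> pos_cone" for u v :: 'a
    using pos_cone_add[OF scalar_minus_pos_cone[OF pos_cone_selfadjoint[OF that(1)] that(2)] that(3)]
    by (simp add: algebra_simps)
  fix t assume t: "complex_of_real t \<in> spectrum (x - y)"
  have "complex_of_real (1 - t) \<in> spectrum (1 *\<^sub>R 1 - (x - y))"
    using t by (simp only: spectrum_scalar_minus) simp
  then have "t \<le> 1" using pos_cone_spectrum_nonneg[OF pos[OF x y(1)], of "1 - t"] by simp
  moreover have "complex_of_real (- t) \<in> spectrum (y - x)"
    using t spectrum_minus[of "complex_of_real (- t)" "x - y"] by simp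
  then have "complex_of_real (1 + t) \<in> spectrum (1 *\<^sub>R 1 - (y - x))"
    by (simp only: spectrum_scalar_minus) simp
  then have "-1 \<le> t" using pos_cone_spectrum_nonneg[OF pos[OF y x(1)], of "1 + t"] by simp
  ultimately show "\<bar>t\<bar> \<le> 1" by simp
qed

text \<open>The square root is the limit of \<open>P\<^sub>n(a)\<close> for polynomials \<open>P\<^sub>n\<close> that approximate the real
  square root uniformly on \<open>[0, \<parallel>a\<parallel>]\<close>.\<close>

lemma pos_cone_sqrt:
  fixes a :: "'a::unital_cstar_algebra"
  assumes a: "a \<in> pos_cone"
  obtains r where "r \<in> pos_cone" "r * r = a" "\<And>b. a * b = b * a \<Longrightarrow> r * b = b * r"
proof -
  have sa: "star a = a" using a by (rule pos_cone_selfadjoint)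
  have spec: "t \<in> {0..norm a}" if "complex_of_real t \<in> spectrum a" for t
    using pos_cone_spectrum_nonneg[OF a that] real_spectrum_le_norm[OF that] by simp
  define N where "N = sqrt (norm a)"
  have N: "0 \<le> N" by (simp add: N_def)
  have bound: "0 \<le> sqrt t \<and> sqrt t \<le> N \<and> sqrt t * sqrt t = t" if "t \<in> {0..norm a}" for t
    using that by (simp add: N_def)
  have "\<exists>P. \<forall>t\<in>{0..norm a}. \<bar>sqrt t - poly P t\<bar> < e" if e: "e > 0" for e
  proof -
    have "continuous_on {0..norm a} sqrt" by (intro continuous_intros)
    then obtain g where g: "real_polynomial_function g" "\<And>t. t \<in> {0..norm a} \<Longrightarrow> \<bar>sqrt t - g t\<bar> < e"
      using Stone_Weierstrass_real_polynomial_function[OF compact_Icc _ e] by blast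
    obtain c n where "g = (\<lambda>t. \<Sum>i\<le>n. c i * t ^ i)"
      using g(1) unfolding real_polynomial_function_iff_sum by blast
    then have "poly (\<Sum>i\<le>n. monom (c i) i) = g" by (auto simp: poly_sum poly_monom)
    then show ?thesis using g(2) by metis
  qed
  then have "\<forall>n. \<exists>P. \<forall>t\<in>{0..norm a}. \<bar>sqrt t - poly P t\<bar> < 1 / Suc n" by simp
  then obtain P where P: "\<And>n t. t \<in> {0..norm a} \<Longrightarrow> \<bar>sqrt t - poly (P n) t\<bar> < 1 / Suc n" by metis
  define R where "R n = real_poly_apply (P n) a" for n
  have "Cauchy R"
  proof (rule metric_CauchyI)
    fix e :: real assume e: "e > 0"
    obtain k where k: "1 / Suc k < e / 2" using e nat_approx_posE by (metis half_gt_zero)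
    have "dist (R m) (R n) < e" if "m \<ge> k" "n \<ge> k" for m n
    proof -
      have small: "1 / Suc l \<le> 1 / Suc k" if "l \<ge> k" for l using that by (intro divide_left_mono) auto
      have "norm (real_poly_apply (P m - P n) a) \<le> 1 / Suc k + 1 / Suc k"
      proof (rule norm_real_poly_apply_le[OF sa])
        fix t assume "complex_of_real t \<in> spectrum a"
        then show "\<bar>poly (P m - P n) t\<bar> \<le> 1 / Suc k + 1 / Suc k"
          using P[OF spec, of t m] P[OF spec, of t n] small[of m] small[of n] that by simp
      qed
      then show ?thesis using k by (simp add: dist_norm R_def real_poly_apply_diff)
    qed
    then show "\<exists>M. \<forall>m\<ge>M. \<forall>n\<ge>M. dist (R m) (R n) < e" by blast
  qed
  then obtain r where r: "R \<longlonglongrightarrow> r" using Cauchy_convergent convergentD by blast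
  have null: "(\<lambda>n. c * (1 / Suc n)) \<longlonglongrightarrow> 0" for c
    using LIMSEQ_inverse_real_of_nat by (intro tendsto_mult_right_zero) (simp add: inverse_eq_divide)
  have "r * r = a"
  proof -
    have "(\<lambda>n. R n * R n - a) \<longlonglongrightarrow> 0"
    proof (rule Lim_null_comparison[OF _ null])
      show "\<forall>\<^sub>F n in sequentially. norm (R n * R n - a) \<le> (2 * N + 1) * (1 / Suc n)"
      proof (rule always_eventually, rule allI)
        fix n
        have "R n * R n - a = real_poly_apply (P n * P n - [:0, 1:]) a"
          by (simp add: R_def real_poly_apply_diff real_poly_apply_mult)
        moreover have "norm (real_poly_apply (P n * P n - [:0, 1:]) a) \<le> (2 * N + 1) * (1 / Suc n)"
        proof (rule norm_real_poly_apply_le[OF sa])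
          fix t assume "complex_of_real t \<in> spectrum a"
          then have t: "t \<in> {0..norm a}" by (rule spec)
          have "poly (P n * P n - [:0, 1:]) t = (poly (P n) t + sqrt t) * (poly (P n) t - sqrt t)"
            using bound[OF t] by (simp add: algebra_simps)
          moreover have "1 / Suc n \<le> (1::real)" by simp
          then have "\<bar>poly (P n) t + sqrt t\<bar> \<le> 2 * N + 1"
            using bound[OF t] P[OF t, of n] unfolding abs_le_iff abs_less_iff by linarith
          moreover have "\<bar>poly (P n) t - sqrt t\<bar> \<le> 1 / Suc n" using P[OF t, of n] by simp
          ultimately show "\<bar>poly (P n * P n - [:0, 1:]) t\<bar> \<le> (2 * N + 1) * (1 / Suc n)"
            by (simp only: abs_mult) (intro mult_mono, auto simp: N)
        qed
        ultimately show "norm (R n * R n - a) \<le> (2 * N + 1) * (1 / Suc n)" by simp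
      qed
    qed
    then have "(\<lambda>n. R n * R n) \<longlonglongrightarrow> a" by (simp add: LIM_zero_iff)
    moreover have "(\<lambda>n. R n * R n) \<longlonglongrightarrow> r * r" by (intro tendsto_mult r)
    ultimately show ?thesis using LIMSEQ_unique by blast
  qed
  moreover have "r \<in> pos_cone"
  proof -
    have starR: "star (R n) = R n" for n unfolding R_def by (rule star_real_poly_apply[OF sa])
    have "R \<longlonglongrightarrow> star r" using tendsto_star[OF r] unfolding starR .
    then have sr: "star r = r" using r LIMSEQ_unique by blast
    have lim: "(\<lambda>n. N + 1 * (1 / Suc n)) \<longlonglongrightarrow> N + 0" by (intro tendsto_add tendsto_const null)
    have "norm (R n) \<le> N + 1 * (1 / Suc n)" for n
      unfolding R_def
    proof (rule norm_real_poly_apply_le[OF sa])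
      fix t assume "complex_of_real t \<in> spectrum a"
      then have t: "t \<in> {0..norm a}" by (rule spec)
      show "\<bar>poly (P n) t\<bar> \<le> N + 1 * (1 / Suc n)" using bound[OF t] P[OF t, of n] by linarith
    qed
    then have "norm r \<le> N + 0" by (intro LIMSEQ_le[OF tendsto_norm[OF r] lim]) auto
    moreover have "norm (N *\<^sub>R 1 - R n) \<le> N + 1 * (1 / Suc n)" for n
    proof -
      have "N *\<^sub>R 1 - R n = real_poly_apply ([:N:] - P n) a" by (simp add: R_def real_poly_apply_diff)
      moreover have "norm (real_poly_apply ([:N:] - P n) a) \<le> N + 1 * (1 / Suc n)"
      proof (rule norm_real_poly_apply_le[OF sa])
        fix t assume "complex_of_real t \<in> spectrum a"
        then have t: "t \<in> {0..norm a}" by (rule spec)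
        have "poly ([:N:] - P n) t = N - poly (P n) t" by simp
        then show "\<bar>poly ([:N:] - P n) t\<bar> \<le> N + 1 * (1 / Suc n)"
          using bound[OF t] P[OF t, of n] by linarith
      qed
      ultimately show ?thesis by simp
    qed
    then have "norm (N *\<^sub>R 1 - r) \<le> N + 0"
      by (intro LIMSEQ_le[OF tendsto_norm[OF tendsto_diff[OF tendsto_const r]] lim]) auto
    ultimately show ?thesis using sr by (simp add: pos_cone_iff_norm)
  qed
  moreover have "r * b = b * r" if "a * b = b * a" for b
  proof -
    have "(\<lambda>n. R n * b) \<longlonglongrightarrow> r * b" "(\<lambda>n. b * R n) \<longlonglongrightarrow> b * r"
      by (intro tendsto_mult tendsto_const r)+
    moreover have "R n * b = b * R n" for n unfolding R_def by (rule real_poly_apply_commute[OF that])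
    ultimately show ?thesis using LIMSEQ_unique by auto
  qed
  ultimately show thesis using that by blast
qed

text \<open>An inverse \<open>c\<close> of \<open>z - ba\<close> yields the inverse \<open>z\<^sup>-\<^sup>1(1 + acb)\<close> of \<open>z - ab\<close>.\<close>

lemma spectrum_mult_commute:
  fixes a b :: "'a::unital_cstar_algebra"
  assumes z: "z \<noteq> 0" "z \<in> spectrum (a * b)"
  shows "z \<in> spectrum (b * a)"
proof (rule ccontr)
  assume "z \<notin> spectrum (b * a)"
  then obtain c where c: "(z *\<^sub>C 1 - b * a) * c = 1" "c * (z *\<^sub>C 1 - b * a) = 1"
    unfolding spectrum_def is_invertible_def by blast
  have "z *\<^sub>C c - b * (a * c) = 1"
    using c(1) by (simp add: left_diff_distrib scaleC_mult_left mult.assoc)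
  then have c1: "b * (a * c) = z *\<^sub>C c - 1" by (metis diff_diff_eq2 add_diff_cancel_left')
  have "z *\<^sub>C c - c * (b * a) = 1"
    using c(2) by (simp add: right_diff_distrib scaleC_mult_right)
  then have c2: "c * (b * a) = z *\<^sub>C c - 1" by (metis diff_diff_eq2 add_diff_cancel_left')
  let ?d = "inverse z *\<^sub>C (1 + a * c * b)"
  have "(a * b) * (a * c * b) = a * (b * (a * c)) * b" by (simp add: mult.assoc)
  also have "\<dots> = z *\<^sub>C (a * c * b) - a * b"
    unfolding c1 by (simp add: right_diff_distrib left_diff_distrib scaleC_mult_left scaleC_mult_right)
  finally have d1: "(a * b) * (a * c * b) = z *\<^sub>C (a * c * b) - a * b" .
  have "(a * c * b) * (a * b) = a * (c * (b * a)) * b" by (simp add: mult.assoc)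
  also have "\<dots> = z *\<^sub>C (a * c * b) - a * b"
    unfolding c2 by (simp add: right_diff_distrib left_diff_distrib scaleC_mult_left scaleC_mult_right)
  finally have d2: "(a * c * b) * (a * b) = z *\<^sub>C (a * c * b) - a * b" .
  have "(z *\<^sub>C 1 - a * b) * ?d = inverse z *\<^sub>C (z *\<^sub>C 1)"
    unfolding scaleC_mult_right left_diff_distrib distrib_left d1
    by (simp add: scaleC_mult_left scaleC_add_right)
  moreover have "?d * (z *\<^sub>C 1 - a * b) = inverse z *\<^sub>C (z *\<^sub>C 1)"
    unfolding scaleC_mult_left right_diff_distrib distrib_right d2
    by (simp add: scaleC_mult_right scaleC_add_right)
  ultimately have "is_invertible (z *\<^sub>C 1 - a * b)"
    using z(1) unfolding is_invertible_def by (intro exI[of _ ?d]) (simp add: scaleC_scaleC)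
  then show False using z(2) by (simp add: spectrum_def)
qed

text \<open>Here \<open>a\<^sup>*a + aa\<^sup>*\<close> is positive, being half the sum of the squares of the self-adjoint elements
  \<open>a + a\<^sup>*\<close> and \<open>\<i>(a - a\<^sup>*)\<close>. So \<open>aa\<^sup>*\<close> is positive if \<open>-a\<^sup>*a\<close> is; but \<open>a\<^sup>*a\<close> has
  the same nonzero spectrum as \<open>aa\<^sup>*\<close>.\<close>

lemma eq_0_if_minus_star_mult_pos:
  fixes a :: "'a::unital_cstar_algebra"
  assumes "- (star a * a) \<in> pos_cone"
  shows "a = 0"
proof -
  define b where "b = a + star a"
  define c where "c = \<i> *\<^sub>C (a - star a)"
  have "star b = b" by (simp add: b_def star_add star_star add.commute)
  moreover have "star c = c"
    by (simp add: c_def star_scaleC star_diff star_star scaleC_diff_right)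
  ultimately have "b * b + c * c \<in> pos_cone" by (intro pos_cone_add pos_cone_square)
  then have "(1/2) *\<^sub>R (b * b + c * c) \<in> pos_cone" by (rule pos_cone_scaleR) simp
  moreover have cc: "c * c = - ((a - star a) * (a - star a))"
    by (simp add: c_def scaleC_mult_left scaleC_mult_right scaleC_scaleC)
  have "b * b + c * c = 2 *\<^sub>R (star a * a + a * star a)"
    unfolding cc b_def by (simp add: algebra_simps scaleR_2)
  then have "(1/2) *\<^sub>R (b * b + c * c) = star a * a + a * star a"
    by (simp only: scaleR_scaleR) simp
  ultimately have "star a * a + a * star a \<in> pos_cone" by metis
  from pos_cone_add[OF this assms] have pos: "a * star a \<in> pos_cone" by simp
  have "star a * a \<in> pos_cone"
  proof (rule pos_coneI)
    fix t assume t: "complex_of_real t \<in> spectrum (star a * a)"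
    show "0 \<le> t"
    proof (cases "t = 0")
      case False
      then have "complex_of_real t \<in> spectrum (a * star a)" using spectrum_mult_commute[OF _ t] by simp
      then show ?thesis using pos_cone_spectrum_nonneg[OF pos] by blast
    qed simp
  qed (simp add: star_mult star_star)
  then have "star a * a = 0" using assms by (rule pos_cone_antisym)
  then have "(norm a)\<^sup>2 = 0" using cstar_identity[of a] by (metis norm_zero)
  then show ?thesis by simp
qed

text \<open>With \<open>w = a\<^sup>*a\<close> and \<open>v = (\<bar>w\<bar> - w)/2\<close> its negative part, \<open>(av)\<^sup>*(av) = -\<bar>w\<bar>v\<^sup>2\<close> is the
  negative of a square, so \<open>av = 0\<close>, which forces \<open>v = 0\<close> and \<open>w = \<bar>w\<bar>\<close>.\<close>

lemma star_mult_pos_cone: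
  fixes a :: "'a::unital_cstar_algebra"
  shows "star a * a \<in> pos_cone"
proof -
  define w where "w = star a * a"
  have sw: "star w = w" by (simp add: w_def star_mult star_star)
  obtain m where m: "m \<in> pos_cone" "m * m = w * w" and comm: "\<And>b. (w * w) * b = b * (w * w) \<Longrightarrow> m * b = b * m"
    using pos_cone_sqrt[OF pos_cone_square[OF sw]] by blast
  have mw: "m * w = w * m" by (rule comm) (rule mult.assoc)
  have sm: "star m = m" using m by (simp add: pos_cone_selfadjoint)
  define v where "v = (1/2) *\<^sub>R (m - w)"
  have sv: "star v = v" by (simp add: v_def star_scaleR star_diff sm sw)
  have mv: "m * v = v * m" using mw by (simp add: v_def algebra_simps)
  have wv: "w * v = - (m * v)" using mw m(2) by (simp add: v_def algebra_simps)
  obtain q where q: "q \<in> pos_cone" "q * q = m" and comm_q: "\<And>b. m * b = b * m \<Longrightarrow> q * b = b * q"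
    using pos_cone_sqrt[OF m(1)] by blast
  have qv: "q * v = v * q" by (rule comm_q[OF mv])
  have sqv: "star (q * v) = q * v"
    unfolding star_mult sv pos_cone_selfadjoint[OF q(1)] by (rule qv[symmetric])
  have sq: "(q * v) * (q * v) = v * (m * v)"
  proof -
    have "(q * v) * (q * v) = (v * q) * (q * v)" by (simp only: qv)
    also have "\<dots> = v * ((q * q) * v)" by (simp only: mult.assoc)
    finally show ?thesis by (simp only: q(2))
  qed
  have "star (a * v) * (a * v) = v * (w * v)" by (simp add: star_mult sv w_def mult.assoc)
  then have eq: "star (a * v) * (a * v) = - ((q * v) * (q * v))" by (simp add: wv sq)
  then have "- (star (a * v) * (a * v)) \<in> pos_cone" using pos_cone_square[OF sqv] by simp
  then have "a * v = 0" by (rule eq_0_if_minus_star_mult_pos)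
  then have "w * v = 0" by (simp add: w_def mult.assoc)
  then have "m * v = 0" using wv by simp
  moreover have "v * v = (1/2) *\<^sub>R (m * v - w * v)"
    by (subst (1) v_def) (simp add: left_diff_distrib)
  ultimately have "v * v = 0" using \<open>w * v = 0\<close> by simp
  then have "(norm v)\<^sup>2 = 0" using cstar_identity[of v] unfolding sv by (metis norm_zero)
  then have "v = 0" by simp
  then have "m = w" by (simp add: v_def)
  then show ?thesis using m(1) by (simp add: w_def)
qed

lemma pos_cone_conjugate:
  fixes a :: "'a::unital_cstar_algebra"
  assumes "a \<in> pos_cone"
  shows "star z * a * z \<in> pos_cone"
proof -
  obtain r where r: "r \<in> pos_cone" "r * r = a" by (rule pos_cone_sqrt[OF assms])
  have "star z * a * z = star (r * z) * (r * z)"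
    unfolding r(2)[symmetric] star_mult pos_cone_selfadjoint[OF r(1)] by (simp only: mult.assoc)
  then show ?thesis by (simp add: star_mult_pos_cone)
qed

text \<open>A Cauchy--Schwarz inequality for the form \<open>z \<mapsto> z\<^sup>*az\<close>: if \<open>z\<^sup>*az\<close> is small, so is \<open>az\<close>.\<close>

lemma norm_mult_pos_cone_le:
  fixes a :: "'a::unital_cstar_algebra"
  assumes "a \<in> pos_cone"
  shows "(norm (a * z))\<^sup>2 \<le> norm a * norm (star z * a * z)"
proof -
  obtain r where r: "r \<in> pos_cone" "r * r = a" by (rule pos_cone_sqrt[OF assms])
  have sr: "star r = r" using r(1) by (rule pos_cone_selfadjoint)
  have "norm (a * z) \<le> norm r * norm (r * z)"
    unfolding r(2)[symmetric] mult.assoc by (rule norm_mult_ineq)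
  then have "(norm (a * z))\<^sup>2 \<le> (norm r)\<^sup>2 * (norm (r * z))\<^sup>2"
    by (metis norm_ge_zero power_mono power_mult_distrib)
  moreover have "(norm r)\<^sup>2 = norm a" using cstar_identity[of r] unfolding sr r(2) by simp
  moreover have "star (r * z) * (r * z) = star z * a * z"
    unfolding r(2)[symmetric] star_mult sr by (simp only: mult.assoc)
  then have "(norm (r * z))\<^sup>2 = norm (star z * a * z)"
    by (metis cstar_identity)
  ultimately show ?thesis by simp
qed

section \<open>Approximate eigenvectors inside the algebra\<close>

lemma one_minus_mult_power_le:
  fixes t :: real
  assumes "0 \<le> t" "t \<le> 1"
  shows "(1 - t) * t ^ n \<le> 1 / Suc n"
proof -
  have "real (Suc n) * t ^ n = (\<Sum>i<Suc n. t ^ n)" by simp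
  also have "\<dots> \<le> (\<Sum>i<Suc n. t ^ i)" using assms by (intro sum_mono power_decreasing) auto
  finally have "real (Suc n) * t ^ n * (1 - t) \<le> (\<Sum>i<Suc n. t ^ i) * (1 - t)"
    using assms by (intro mult_right_mono) auto
  also have "\<dots> = 1 - t ^ Suc n" by (rule sum_powers_mult_one_minus)
  also have "\<dots> \<le> 1" using assms by simp
  finally have "real (Suc n) * ((1 - t) * t ^ n) \<le> 1" by (simp only: mult_ac)
  then show ?thesis by (simp only: le_divide_eq mult_ac) simp
qed

text \<open>The powers of a positive contraction \<open>u\<close> concentrate where \<open>u\<close> is close to \<open>1\<close>.
  If \<open>\<parallel>u\<parallel> = 1\<close>, they have norm \<open>1\<close> and so are approximate eigenvectors for the value \<open>1\<close>.\<close>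

lemma one_minus_mult_power_tendsto_0:
  fixes u :: "'a::unital_cstar_algebra"
  assumes u: "u \<in> pos_cone" "norm u \<le> 1"
  shows "(\<lambda>n. (1 - u) * u ^ n) \<longlonglongrightarrow> 0"
proof (rule Lim_null_comparison)
  show "(\<lambda>n. 1 / Suc n) \<longlonglongrightarrow> 0"
    using LIMSEQ_inverse_real_of_nat by (simp add: inverse_eq_divide)
  show "\<forall>\<^sub>F n in sequentially. norm ((1 - u) * u ^ n) \<le> 1 / Suc n"
  proof (rule always_eventually, rule allI)
    fix n
    have "norm (real_poly_apply ([:1, -1:] * [:0, 1:] ^ n) u) \<le> 1 / Suc n"
    proof (rule norm_real_poly_apply_le[OF pos_cone_selfadjoint[OF u(1)]])
      fix t assume t: "complex_of_real t \<in> spectrum u"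
      have t01: "0 \<le> t" "t \<le> 1"
        using pos_cone_spectrum_nonneg[OF u(1) t] real_spectrum_le_norm[OF t] u(2) by linarith+
      have "poly ([:1, -1:] * [:0, 1:] ^ n) t = (1 - t) * t ^ n"
        by (simp add: poly_power left_diff_distrib)
      moreover have "0 \<le> (1 - t) * t ^ n" using t01 by simp
      ultimately show "\<bar>poly ([:1, -1:] * [:0, 1:] ^ n) t\<bar> \<le> 1 / Suc n"
        using one_minus_mult_power_le[OF t01, of n] by linarith
    qed
    then show "norm ((1 - u) * u ^ n) \<le> 1 / Suc n"
      unfolding real_poly_apply_mult real_poly_apply_power by simp
  qed
qed

lemma tendsto_0_if_norm_square_le:
  fixes f :: "nat \<Rightarrow> 'a::real_normed_vector" and g :: "nat \<Rightarrow> 'b::real_normed_vector"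
  assumes "\<And>n. (norm (f n))\<^sup>2 \<le> c * norm (g n)" "g \<longlonglongrightarrow> 0"
  shows "f \<longlonglongrightarrow> 0"
proof -
  have "(\<lambda>n. c * norm (g n)) \<longlonglongrightarrow> 0"
    using tendsto_norm_zero[OF assms(2)] by (rule tendsto_mult_right_zero)
  then have "(\<lambda>n. (norm (f n))\<^sup>2) \<longlonglongrightarrow> 0"
    by (rule Lim_null_comparison[rotated]) (use assms(1) in simp)
  then have "(\<lambda>n. sqrt ((norm (f n))\<^sup>2)) \<longlonglongrightarrow> sqrt 0" by (rule tendsto_real_sqrt)
  then show ?thesis by (simp add: tendsto_norm_zero_iff)
qed

lemma norm_ge_1_if_approximate_eigenvector:
  fixes a :: "'a::real_normed_algebra"
  assumes z: "\<And>n. norm (z n) = 1" and "(\<lambda>n. a * z n - z n) \<longlonglongrightarrow> 0"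
  shows "1 \<le> norm a"
proof -
  have "(\<lambda>n. 1 - norm (a * z n - z n)) \<longlonglongrightarrow> 1 - 0"
    by (intro tendsto_diff tendsto_const tendsto_norm_zero assms(2))
  moreover have "1 - norm (a * z n - z n) \<le> norm a" for n
    using norm_mult_ineq[of a "z n"] norm_triangle_ineq2[of "z n" "a * z n"] z[of n]
    by (simp add: norm_minus_commute)
  ultimately show ?thesis by (intro LIMSEQ_le_const2[of _ "1::real" "norm a"]) auto
qed

text \<open>Two positive summands cannot cancel: \<open>z\<^sup>*az \<le> z\<^sup>*(a + b)z\<close> is small as soon as \<open>(a + b)z\<close> is.\<close>

lemma pos_summand_tendsto_0:
  fixes a b :: "'a::unital_cstar_algebra"
  assumes a: "a \<in> pos_cone" and b: "b \<in> pos_cone"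
    and z: "\<And>n. norm (z n) = 1" and lim: "(\<lambda>n. (a + b) * z n) \<longlonglongrightarrow> 0"
  shows "(\<lambda>n. a * z n) \<longlonglongrightarrow> 0"
proof (rule tendsto_0_if_norm_square_le[OF _ lim])
  fix n
  have "star (z n) * (a + b) * z n - star (z n) * a * z n = star (z n) * b * z n"
    by (simp add: algebra_simps)
  then have "norm (star (z n) * a * z n) \<le> norm (star (z n) * (a + b) * z n)"
    using pos_cone_conjugate[OF a, of "z n"] pos_cone_conjugate[OF b, of "z n"]
    by (intro norm_mono_pos_cone) simp_all
  also have "\<dots> \<le> norm ((a + b) * z n)"
    using norm_mult_ineq[of "star (z n)" "(a + b) * z n"] z[of n] by (simp only: mult.assoc norm_star)
  finally have "norm a * norm (star (z n) * a * z n) \<le> norm a * norm ((a + b) * z n)"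
    by (intro mult_left_mono) auto
  then show "(norm (a * z n))\<^sup>2 \<le> norm a * norm ((a + b) * z n)"
    using norm_mult_pos_cone_le[OF a, of "z n"] by linarith
qed

lemma approximate_eigenvectors_of_diff:
  fixes x y :: "'a::unital_cstar_algebra"
  assumes x: "x \<in> pos_cone" "norm x \<le> 1" and y: "y \<in> pos_cone" "norm y \<le> 1"
    and one: "1 \<in> spectrum (x - y)"
  obtains z where "\<And>n. norm (z n) = 1" "(\<lambda>n. x * z n - z n) \<longlonglongrightarrow> 0" "(\<lambda>n. y * z n) \<longlonglongrightarrow> 0"
proof -
  have sx: "1 - x \<in> pos_cone" and sy: "1 - y \<in> pos_cone"
    using scalar_minus_pos_cone[of x 1] scalar_minus_pos_cone[of y 1] x y
    by (simp_all add: pos_cone_selfadjoint)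
  \<comment> \<open>\<open>1 - w\<close> is half the sum of the positive elements \<open>1 - x\<close> and \<open>y\<close>, so vectors nearly fixed by
    \<open>w\<close> are nearly annihilated by both.\<close>
  define w where "w = (1/2) *\<^sub>R (1 - y + x)"
  have w: "w \<in> pos_cone" unfolding w_def by (intro pos_cone_scaleR pos_cone_add sy x(1)) simp
  have "norm (1 + (x - y)) \<le> norm (1::'a) + norm (x - y)" by (rule norm_triangle_ineq)
  moreover have "1 + (x - y) = 1 - y + x" by simp
  ultimately have le: "norm w \<le> 1" using norm_diff_le_1[OF x y] by (simp add: w_def)
  have wC: "w = (1/2) *\<^sub>C ((x - y) + 1 *\<^sub>C 1)"
    using scaleC_of_real[of "1/2" "1 - y + x"] by (simp add: w_def algebra_simps)
  have "2 \<in> spectrum ((x - y) + 1 *\<^sub>C 1)" unfolding spectrum_add_scaleC using one by simp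
  then have "complex_of_real 1 \<in> spectrum w" unfolding wC by (subst spectrum_scaleC) simp_all
  from real_spectrum_le_norm[OF this] le have nw: "norm w = 1" by simp
  define z where "z n = w ^ n" for n
  have z: "norm (z n) = 1" for n
    unfolding z_def by (rule norm_power_eq_1[OF pos_cone_selfadjoint[OF w] nw])
  have "(\<lambda>n. 2 *\<^sub>R ((1 - w) * z n)) \<longlonglongrightarrow> 2 *\<^sub>R 0"
    unfolding z_def by (intro tendsto_scaleR tendsto_const one_minus_mult_power_tendsto_0[OF w le])
  moreover have "2 *\<^sub>R (1 - w) = (1 - x) + y"
    by (simp add: w_def algebra_simps scaleR_2)
  ultimately have lim: "(\<lambda>n. ((1 - x) + y) * z n) \<longlonglongrightarrow> 0" by (simp flip: mult_scaleR_left)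
  have "(\<lambda>n. - ((1 - x) * z n)) \<longlonglongrightarrow> - 0"
    by (intro tendsto_minus pos_summand_tendsto_0[OF sx y(1) z lim])
  moreover have "(\<lambda>n. (y + (1 - x)) * z n) \<longlonglongrightarrow> 0" using lim by (simp only: add.commute)
  then have "(\<lambda>n. y * z n) \<longlonglongrightarrow> 0" by (rule pos_summand_tendsto_0[OF y(1) sx z])
  ultimately show thesis using that[of z] z by (simp add: left_diff_distrib)
qed

text \<open>The distance of two positive contractions is \<open>1\<close> only if some approximate eigenvectors are
  nearly fixed by one of them and nearly annihilated by the other.\<close>

lemma norm_diff_eq_1_cases:
  fixes x y :: "'a::unital_cstar_algebra"
  assumes x: "x \<in> pos_cone" "norm x \<le> 1" and y: "y \<in> pos_cone" "norm y \<le> 1"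
    and n: "norm (x - y) = 1"
  obtains (left) z where "\<And>n. norm (z n) = 1" "(\<lambda>n. x * z n - z n) \<longlonglongrightarrow> 0" "(\<lambda>n. y * z n) \<longlonglongrightarrow> 0"
  | (right) z where "\<And>n. norm (z n) = 1" "(\<lambda>n. y * z n - z n) \<longlonglongrightarrow> 0" "(\<lambda>n. x * z n) \<longlonglongrightarrow> 0"
proof -
  have "star (x - y) = x - y" using x y by (simp add: star_diff pos_cone_selfadjoint)
  then have "1 \<in> spectrum (x - y) \<or> -1 \<in> spectrum (x - y)"
    using n by (rule spectrum_selfadjoint_norm_1)
  then show thesis
  proof
    assume "1 \<in> spectrum (x - y)"
    from approximate_eigenvectors_of_diff[OF x y this] show thesis using left by blast
  next
    assume "-1 \<in> spectrum (x - y)"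
    then have "1 \<in> spectrum (y - x)" using spectrum_minus[of 1 "x - y"] by simp
    from approximate_eigenvectors_of_diff[OF y x this] show thesis using right by blast
  qed
qed

section \<open>The double unit sphere of an element\<close>

text \<open>An approximate eigenvector of \<open>p\<close> for the value \<open>0\<close> or \<open>1\<close> is one of \<open>p\<^sup>2\<close> for the same value,
  and these are the only eigenvectors on which \<open>\<parallel>s - p\<parallel> = 1\<close> depends. Unless \<open>p\<close> is idempotent, \<open>p\<^sup>2\<close>
  is therefore a second element of the double sphere.\<close>

lemma square_mem_double_sphere:
  fixes p :: "'a::unital_cstar_algebra"
  assumes p: "p \<in> pos_sphere"
  shows "p * p \<in> Sph pos_sphere (Sph pos_sphere {p})"
proof -
  have pp: "p \<in> pos_cone" "norm p = 1" using p by (auto simp: pos_sphere_def)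
  have sp: "star p = p" using pp(1) by (rule pos_cone_selfadjoint)
  have qq: "p * p \<in> pos_cone" "norm (p * p) = 1"
    using pos_cone_square[OF sp] cstar_identity[of p] by (simp_all add: sp pp)
  have "norm (p * p - s) = 1" if s: "s \<in> pos_cone" "norm s = 1" "norm (s - p) = 1" for s
  proof (rule antisym)
    show "norm (p * p - s) \<le> 1" using norm_diff_le_1[of "p * p" s] qq s by simp
    from s(1) s(2)[THEN eq_refl] pp(1) pp(2)[THEN eq_refl] s(3) show "1 \<le> norm (p * p - s)"
    proof (cases rule: norm_diff_eq_1_cases)
      case (left z)
      have "(\<lambda>n. (s * z n - z n) - p * (p * z n)) \<longlonglongrightarrow> 0 - p * 0"
        by (intro tendsto_diff tendsto_mult tendsto_const left)
      moreover have "(s * z n - z n) - p * (p * z n) = (s - p * p) * z n - z n" for n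
        by (simp add: algebra_simps)
      ultimately have "(\<lambda>n. (s - p * p) * z n - z n) \<longlonglongrightarrow> 0" by simp
      from norm_ge_1_if_approximate_eigenvector[OF left(1) this] show ?thesis
        by (simp add: norm_minus_commute)
    next
      case (right z)
      have "(\<lambda>n. p * (p * z n - z n) + (p * z n - z n) - s * z n) \<longlonglongrightarrow> p * 0 + 0 - 0"
        by (intro tendsto_diff tendsto_add tendsto_mult tendsto_const right)
      moreover have "p * (p * z n - z n) + (p * z n - z n) - s * z n = (p * p - s) * z n - z n" for n
        by (simp add: algebra_simps)
      ultimately have "(\<lambda>n. (p * p - s) * z n - z n) \<longlonglongrightarrow> 0" by simp
      from norm_ge_1_if_approximate_eigenvector[OF right(1) this] show ?thesis .
    qed
  qed
  then show ?thesis using qq by (auto simp: Sph_def pos_sphere_def)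
qed

text \<open>Any \<open>y \<noteq> p\<close> on the positive sphere is excluded from the double sphere of a projection \<open>p\<close> by an
  element \<open>x\<close> of the sphere around \<open>p\<close> at distance less than \<open>1\<close> from \<open>y\<close>. If \<open>pyp = p\<close>, then
  \<open>y = p + z\<close> with a positive \<open>z \<noteq> 0\<close> orthogonal to \<open>p\<close>, and enlarging \<open>z\<close> to norm \<open>1\<close> gives \<open>x\<close>.\<close>

lemma close_element_if_corner_eq:
  fixes p y :: "'a::unital_cstar_algebra"
  assumes p: "star p = p" "p * p = p" "norm p = 1"
    and y: "y \<in> pos_cone" "norm y = 1" "y \<noteq> p" and corner: "p * y * p = p"
  shows "\<exists>x\<in>pos_sphere. norm (x - p) = 1 \<and> norm (x - y) < 1"
proof -
  have sy: "star y = y" using y(1) by (rule pos_cone_selfadjoint)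
  have g: "1 - y \<in> pos_cone" using scalar_minus_pos_cone[OF sy, of 1] y by simp
  have "star p * (1 - y) * p = 0"
    using corner p by (simp add: right_diff_distrib left_diff_distrib)
  then have "(norm ((1 - y) * p))\<^sup>2 \<le> 0" using norm_mult_pos_cone_le[OF g, of p] by simp
  then have yp: "y * p = p" by (simp add: left_diff_distrib)
  then have "star (y * p) = star p" by simp
  then have py: "p * y = p" by (simp add: star_mult p sy)
  have sq: "star (1 - p) = 1 - p" by (simp add: star_diff p)
  define z where "z = y - p"
  \<comment> \<open>\<open>yp = p\<close> makes \<open>z\<close> the corner of \<open>y\<close> at \<open>1 - p\<close>.\<close>
  have "z = star (1 - p) * y * (1 - p)"
    unfolding sq z_def by (simp add: left_diff_distrib right_diff_distrib yp py p)
  then have z: "z \<in> pos_cone" using pos_cone_conjugate[OF y(1)] by simp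
  have pp: "p \<in> pos_cone" using pos_cone_square[OF p(1)] p by simp
  define s where "s = norm z"
  have s0: "s > 0" using y by (simp add: s_def z_def)
  have s1: "s \<le> 1" using norm_mono_pos_cone[OF z, of y] pp y by (simp add: s_def z_def)
  define w where "w = (1 / s) *\<^sub>R z"
  have w: "w \<in> pos_cone" unfolding w_def using s0 by (intro pos_cone_scaleR z) simp
  have nw: "norm w = 1" using s0 by (simp add: w_def s_def)
  have pw: "p * w = 0" "w * p = 0"
    by (simp_all add: w_def z_def left_diff_distrib right_diff_distrib yp py p)
  define x where "x = p + w"
  have x: "x \<in> pos_cone" unfolding x_def by (intro pos_cone_add pp w)
  have w1: "1 - w \<in> pos_cone"
    using scalar_minus_pos_cone[OF pos_cone_selfadjoint[OF w], of 1] nw by simp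
  have "1 *\<^sub>R 1 - x = star (1 - p) * (1 - w) * (1 - p)"
    unfolding sq x_def by (simp add: left_diff_distrib right_diff_distrib pw p)
  then have "norm x \<le> 1" using pos_cone_conjugate[OF w1, of "1 - p"] x
    by (intro norm_le_if_scalar_minus_pos) simp_all
  moreover have "x * p = p" by (simp add: x_def distrib_right pw p)
  then have "1 \<le> norm x" using norm_mult_ineq[of x p] p(3) by simp
  ultimately have "x \<in> pos_sphere" using x by (simp add: pos_sphere_def)
  moreover have "norm (x - p) = 1" by (simp add: x_def nw)
  moreover have "x - y = (1 / s - 1) *\<^sub>R z"
    by (simp add: x_def w_def z_def scaleR_left_diff_distrib)
  then have "norm (x - y) = 1 - s" using s0 s1 by (simp add: s_def[symmetric] field_simps)
  then have "norm (x - y) < 1" using s0 by simp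
  ultimately show ?thesis by blast
qed

text \<open>If \<open>pyp \<noteq> p\<close>, then \<open>p(1 - y)p\<close> is a nonzero positive element \<open>dh\<close> with \<open>\<parallel>h\<parallel> = 1\<close>. Think of \<open>h\<close> as
  the projection to a line inside the range of \<open>p\<close> on which \<open>y\<close> is not maximal: \<open>\<parallel>yh\<parallel> < 1\<close>.
  Compressing \<open>y\<close> to the complement of that line by \<open>m = 1 - h\<close> and normalising produces an element
  \<open>x\<close> that vanishes on this line, where \<open>p\<close> is the identity, so \<open>\<parallel>x - p\<parallel> = 1\<close>. If \<open>\<parallel>x - y\<parallel>\<close> were \<open>1\<close>, there would be
  approximate eigenvectors \<open>z\<close> of two possible kinds. If \<open>xz \<approx> 0\<close> and \<open>yz \<approx> z\<close>, then \<open>ymz \<approx> 0\<close>, hence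
  \<open>yhz \<approx> yz \<approx> z\<close>, against \<open>\<parallel>yh\<parallel> < 1\<close>. If \<open>xz \<approx> z\<close> and \<open>yz \<approx> 0\<close>, then \<open>y(mym)z\<close>, a multiple of \<open>yxz\<close>, is
  nearly \<open>0\<close>; positivity of \<open>m\<close> turns this into \<open>m(ymz) \<approx> 0\<close>, so \<open>xz \<approx> 0\<close>.\<close>

lemma close_element_if_corner_ne:
  fixes p y :: "'a::unital_cstar_algebra"
  assumes p: "star p = p" "p * p = p" "norm p = 1"
    and y: "y \<in> pos_cone" "norm y = 1" and corner: "p * y * p \<noteq> p"
  shows "\<exists>x\<in>pos_sphere. norm (x - p) = 1 \<and> norm (x - y) < 1"
proof -
  have sy: "star y = y" using y(1) by (rule pos_cone_selfadjoint)
  have pp: "p \<in> pos_cone" using pos_cone_square[OF p(1)] p by simp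
  have g: "1 - y \<in> pos_cone" using scalar_minus_pos_cone[OF sy, of 1] y by simp
  have ng: "norm (1 - y) \<le> 1" using pos_cone_iff_norm[OF sy, of 1] y by simp
  define c where "c = star p * (1 - y) * p"
  have c: "c \<in> pos_cone" unfolding c_def by (rule pos_cone_conjugate[OF g])
  have c_eq: "c = p - p * y * p"
    unfolding c_def p(1) by (simp add: left_diff_distrib right_diff_distrib p)
  define d where "d = norm c"
  have d0: "d > 0" using corner by (simp add: d_def c_eq)
  have "norm c \<le> norm p * norm (1 - y) * norm p"
    unfolding c_def p(1) using norm_mult_ineq[of "p * (1 - y)" p] norm_mult_ineq[of p "1 - y"] p(3) by simp
  then have d1: "d \<le> 1" using ng p(3) by (simp add: d_def)
  define h where "h = (1 / d) *\<^sub>R c"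
  have h: "h \<in> pos_cone" unfolding h_def using d0 by (intro pos_cone_scaleR c) simp
  have sh: "star h = h" using h by (rule pos_cone_selfadjoint)
  have nh: "norm h = 1" using d0 by (simp add: h_def d_def)
  have c_h: "c = d *\<^sub>R h" using d0 by (simp add: h_def)
  have pc: "p * c = c" "c * p = c"
    by (simp_all add: c_eq left_diff_distrib right_diff_distrib p mult.assoc) (simp add: p flip: mult.assoc)
  have ph: "p * h = h" "h * p = h" by (simp_all add: h_def pc)
  define m where "m = 1 - h"
  have m: "m \<in> pos_cone" unfolding m_def using scalar_minus_pos_cone[OF sh, of 1] nh by simp
  have sm: "star m = m" using m by (rule pos_cone_selfadjoint)
  have yh: "norm (y * h) < 1"
  proof -
    \<comment> \<open>\<open>hyh = h\<^sup>2 - dh\<^sup>3\<close>, and \<open>t\<^sup>2 - dt\<^sup>3 \<le> 1 - d/2\<close> on \<open>[0, 1]\<close> because the difference of the two sides is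
      affine in \<open>d\<close> and nonnegative for \<open>d = 0\<close> and \<open>d = 1\<close>.\<close>
    have "h * y * h = (h * p) * y * (p * h)" by (simp only: ph)
    also have "\<dots> = h * (p * y * p) * h" by (simp only: mult.assoc)
    also have "p * y * p = p - d *\<^sub>R h" using c_eq c_h by simp
    also have "h * (p - d *\<^sub>R h) * h = real_poly_apply [:0, 0, 1, - d:] h"
      by (simp add: left_diff_distrib right_diff_distrib ph mult.assoc)
    finally have "h * y * h = real_poly_apply [:0, 0, 1, - d:] h" .
    moreover have "norm (real_poly_apply [:0, 0, 1, - d:] h) \<le> 1 - d / 2"
    proof (rule norm_real_poly_apply_le[OF sh])
      fix t assume t: "complex_of_real t \<in> spectrum h"
      have t01: "0 \<le> t" "t \<le> 1"
        using pos_cone_spectrum_nonneg[OF h t] real_spectrum_le_norm[OF t] nh by linarith+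
      have eq: "poly [:0, 0, 1, - d:] t = t * t * (1 - d * t)" by (simp add: algebra_simps)
      have "d * t \<le> 1" using mult_mono[of d 1 t 1] d0 d1 t01 by simp
      then have "0 \<le> t * t * (1 - d * t)" using t01 by simp
      moreover have "t * t * (1 - d * t) \<le> 1 - d / 2"
      proof -
        have "0 \<le> (1 - d) * (1 - t * t)"
          using d1 t01 mult_mono[of t 1 t 1] by simp
        moreover have "0 \<le> d * (1 / 2 - t * t * (1 - t))"
        proof -
          have "t * t * (1 - t) \<le> 1 * (t * (1 - t))"
            using t01 mult_right_mono[of t 1 "t * (1 - t)"] by (simp add: mult.assoc)
          moreover have "0 \<le> (t - 1/2) * (t - 1/2)" by simp
          then have "t * (1 - t) \<le> 1 / 4" by (simp add: algebra_simps)
          ultimately show ?thesis using d0 by simp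
        qed
        ultimately show ?thesis by (simp add: algebra_simps)
      qed
      ultimately show "\<bar>poly [:0, 0, 1, - d:] t\<bar> \<le> 1 - d / 2" unfolding eq by linarith
    qed
    ultimately have "(norm (y * h))\<^sup>2 \<le> 1 - d / 2"
      using norm_mult_pos_cone_le[OF y(1), of h] y(2) by (simp add: sh)
    then have "(norm (y * h))\<^sup>2 < 1\<^sup>2" using d0 by simp
    then show ?thesis by (rule power_less_imp_less_base) simp
  qed
  define f where "f = star m * y * m"
  have f: "f \<in> pos_cone" unfolding f_def by (rule pos_cone_conjugate[OF y(1)])
  define e where "e = norm f"
  have e0: "e > 0"
  proof (rule ccontr)
    assume "\<not> ?thesis"
    then have "star m * y * m = 0" by (simp add: e_def f_def)
    then have "(norm (y * m))\<^sup>2 \<le> 0" using norm_mult_pos_cone_le[OF y(1), of m] by simp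
    then have "y * h = y" by (simp add: m_def right_diff_distrib)
    then show False using yh y(2) by simp
  qed
  define x where "x = (1 / e) *\<^sub>R f"
  have x: "x \<in> pos_cone" unfolding x_def using e0 by (intro pos_cone_scaleR f) simp
  have nx: "norm x = 1" using e0 by (simp add: x_def e_def)
  have f_x: "f = e *\<^sub>R x" using e0 by (simp add: x_def)
  have "norm (x - p) = 1"
  proof (rule antisym)
    show "norm (x - p) \<le> 1" using norm_diff_le_1[of x p] x nx pp p(3) by simp
    \<comment> \<open>The powers of \<open>h\<close> are fixed by \<open>p\<close> and nearly annihilated by \<open>m\<close>, hence by \<open>x\<close>; the
      exponent \<open>0\<close> is skipped because \<open>p\<close> need not fix \<open>1\<close>.\<close>
    have "(\<lambda>n. (1 - h) * h ^ Suc n) \<longlonglongrightarrow> 0"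
      using one_minus_mult_power_tendsto_0[OF h] nh by (intro LIMSEQ_Suc) simp
    then have "(\<lambda>n. - ((1 / e) *\<^sub>R (star m * y * ((1 - h) * h ^ Suc n)))) \<longlonglongrightarrow> - ((1 / e) *\<^sub>R (star m * y * 0))"
      by (intro tendsto_intros)
    moreover have "- ((1 / e) *\<^sub>R (star m * y * ((1 - h) * h ^ Suc n))) = (p - x) * h ^ Suc n - h ^ Suc n" for n
    proof -
      have "p * h ^ Suc n = h ^ Suc n" by (simp add: ph flip: mult.assoc)
      moreover have "x * h ^ Suc n = (1 / e) *\<^sub>R (star m * y * (m * h ^ Suc n))"
        by (simp only: x_def f_def mult_scaleR_left mult.assoc)
      ultimately show ?thesis unfolding left_diff_distrib[of p x] m_def by simp
    qed
    ultimately have "(\<lambda>n. (p - x) * h ^ Suc n - h ^ Suc n) \<longlonglongrightarrow> 0" by simp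
    then have "1 \<le> norm (p - x)"
      by (rule norm_ge_1_if_approximate_eigenvector[rotated]) (rule norm_power_eq_1[OF sh nh])
    then show "1 \<le> norm (x - p)" by (simp add: norm_minus_commute)
  qed
  moreover have "norm (x - y) < 1"
  proof (rule ccontr)
    assume "\<not> ?thesis"
    then have n: "norm (x - y) = 1"
      using norm_diff_le_1[OF x _ y(1)] nx y(2) by simp
    from x nx[THEN eq_refl] y(1) y(2)[THEN eq_refl] n show False
    proof (cases rule: norm_diff_eq_1_cases)
      case (right z)
      have fz: "(\<lambda>n. f * z n) \<longlonglongrightarrow> 0"
        unfolding f_x mult_scaleR_left using tendsto_scaleR[OF tendsto_const right(3), of e] by simp
      have "(\<lambda>n. y * (m * z n)) \<longlonglongrightarrow> 0"
      proof (rule tendsto_0_if_norm_square_le[OF _ fz])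
        fix n
        have "star (m * z n) * y * (m * z n) = star (z n) * (f * z n)"
          by (simp only: star_mult f_def mult.assoc)
        then show "(norm (y * (m * z n)))\<^sup>2 \<le> 1 * norm (f * z n)"
          using norm_mult_pos_cone_le[OF y(1), of "m * z n"] norm_mult_ineq[of "star (z n)" "f * z n"]
            right(1)[of n] y(2) by simp
      qed
      then have "(\<lambda>n. (y * z n - z n) - y * (m * z n)) \<longlonglongrightarrow> 0 - 0"
        by (intro tendsto_diff right(2))
      moreover have "(y * z n - z n) - y * (m * z n) = (y * h) * z n - z n" for n
        by (simp add: m_def algebra_simps)
      ultimately have "(\<lambda>n. (y * h) * z n - z n) \<longlonglongrightarrow> 0" by simp
      from norm_ge_1_if_approximate_eigenvector[OF right(1) this] yh show False by simp
    next
      case (left z)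
      have "(\<lambda>n. e *\<^sub>R (y * (x * z n - z n) + y * z n)) \<longlonglongrightarrow> e *\<^sub>R (y * 0 + 0)"
        by (intro tendsto_scaleR tendsto_add tendsto_mult tendsto_const left)
      moreover have "e *\<^sub>R (y * (x * z n - z n) + y * z n) = y * (f * z n)" for n
        by (simp add: f_x algebra_simps)
      ultimately have yfz: "(\<lambda>n. y * (f * z n)) \<longlonglongrightarrow> 0" by simp
      have "(\<lambda>n. m * (y * (m * z n))) \<longlonglongrightarrow> 0"
      proof (rule tendsto_0_if_norm_square_le[OF _ yfz])
        fix n
        let ?v = "y * (m * z n)"
        have "star ?v * m * ?v = star (z n) * (m * (y * (f * z n)))"
          by (simp only: star_mult f_def sm sy mult.assoc)
        then have "norm (star ?v * m * ?v) \<le> norm m * norm (y * (f * z n))"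
          using norm_mult_ineq[of "star (z n)" "m * (y * (f * z n))"]
            norm_mult_ineq[of m "y * (f * z n)"] left(1)[of n] by simp
        then have "norm m * norm (star ?v * m * ?v) \<le> norm m * (norm m * norm (y * (f * z n)))"
          by (rule mult_left_mono) simp
        then show "(norm (m * ?v))\<^sup>2 \<le> (norm m * norm m) * norm (y * (f * z n))"
          using norm_mult_pos_cone_le[OF m, of ?v] unfolding mult.assoc by linarith
      qed
      moreover have "m * (y * (m * z n)) = e *\<^sub>R (x * z n)" for n
        using arg_cong[OF f_x, of "\<lambda>a. a * z n"] by (simp add: f_def sm mult.assoc)
      ultimately have "(\<lambda>n. e *\<^sub>R (x * z n)) \<longlonglongrightarrow> 0" by simp
      from tendsto_scaleR[OF tendsto_const this, of "1 / e"]
      have "(\<lambda>n. x * z n) \<longlonglongrightarrow> 0" using e0 by simp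
      from tendsto_diff[OF this left(2)] have "z \<longlonglongrightarrow> 0" by simp
      then have "(\<lambda>n. norm (z n)) \<longlonglongrightarrow> 0" by (rule tendsto_norm_zero)
      then show False using left(1) by (simp add: LIMSEQ_const_iff)
    qed
  qed
  moreover have "x \<in> pos_sphere" using x nx by (simp add: pos_sphere_def)
  ultimately show ?thesis by blast
qed

theorem theorem2p1:
  fixes p :: "'a::unital_cstar_algebra"
  assumes "p \<in> pos_cone" and "norm p = 1"
  shows "is_projection p \<longleftrightarrow> Sph pos_sphere (Sph pos_sphere {p}) = {p}"
proof
  have sphere: "p \<in> pos_sphere" using assms by (simp add: pos_sphere_def)
  {
    assume "Sph pos_sphere (Sph pos_sphere {p}) = {p}"
    then have "p * p = p" using square_mem_double_sphere[OF sphere] by simp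
    then show "is_projection p"
      using pos_cone_selfadjoint[OF assms(1)] by (simp add: is_projection_def power2_eq_square)
  next
    assume "is_projection p"
    then have p: "star p = p" "p * p = p" by (auto simp: is_projection_def power2_eq_square)
    have "y = p" if y: "y \<in> Sph pos_sphere (Sph pos_sphere {p})" for y
    proof (rule ccontr)
      assume "y \<noteq> p"
      have "y \<in> pos_cone" "norm y = 1" using y by (auto simp: Sph_def pos_sphere_def)
      then obtain x where x: "x \<in> pos_sphere" "norm (x - p) = 1" "norm (x - y) < 1"
        using close_element_if_corner_eq[OF p assms(2)] close_element_if_corner_ne[OF p assms(2)] \<open>y \<noteq> p\<close>
        by blast
      then have "x \<in> Sph pos_sphere {p}" by (simp add: Sph_def)
      then show False using y x(3) by (auto simp: Sph_def norm_minus_commute)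
    qed
    moreover have "p \<in> Sph pos_sphere (Sph pos_sphere {p})"
      using sphere by (auto simp: Sph_def norm_minus_commute)
    ultimately show "Sph pos_sphere (Sph pos_sphere {p}) = {p}" by blast
  }
qed

end
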